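(* Let $\mu$ and $\nu$ be compactly supported probability measures on $\mathbb{R}$ (the distributions of two bounded self-adjoint free random variables $X_1,X_2$), and let $\mu\boxplus\nu$ be their free additive convolution (the distribution of $X_1+X_2$). Then $$F_{\mu\boxplus\nu}(z)=\lim_{m\to\infty}F_{\mu}\bigl(F_{\nu\vdash_m\mu}(z)\bigr),$$ $$K_{\mu\boxplus\nu}(z)=\lim_{m\to\infty}\bigl(K_{\mu\vdash_m\nu}(z)+K_{\nu\vdash_m\mu}(z)\bigr),$$ where the convergence is uniform on compact subsets of $\mathbb{C}^+$.
   Context: $\mathbb{C}^+$ is the open upper half-plane. For a probability measure $\mu$ on $\mathbb{R}$: $G_\mu(z)=\int_{\mathbb{R}}\frac{\mu(dx)}{z-x}$ ($z\in\mathbb{C}^+$), $F_\mu(z)=1/G_\mu(z)$ (reciprocal Cauchy transform) and $K_\mu(z)=z-F_\mu(z)$ ($K$-transform). The orthogonal convolution $\mu\vdash\nu$ of probability measures $\mu,\nu$ is the unique probability measure on $\mathbb{R}$ with $F_{\mu\vdash\nu}(z)=F_\mu(F_\nu(z))-F_\nu(z)+z$ on $\mathbb{C}^+$ (equivalently $K_{\mu\vdash\nu}(z)=K_\mu(z-K_\nu(z))$); it is compactly supported if $\mu,\nu$ are. The iterated orthogonal convolutions are defined recursively (for all $\mu,\nu$) by $\mu\vdash_1\nu=\mu\vdash\nu$ and $\mu\vdash_n\nu=\mu\vdash(\nu\vdash_{n-1}\mu)$ for $n\ge 2$. The free additive convolution $\boxplus$ is Voiculescu's. *)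

theory Defs
  imports "HOL-Probability.Probability" "HOL-Library.Nonpos_Ints"
begin

section \<open>Transforms of probability measures on the real line\<close>

text \<open>Probability measures on the Borel sets of the reals are the instances of the library locale
  \<^locale>\<open>real_distribution\<close>.\<close>

definition compactly_supported :: "real measure \<Rightarrow> bool" where
  "compactly_supported \<mu> \<longleftrightarrow> (\<exists>C. compact C \<and> (AE x in \<mu>. x \<in> C))"

definition upper_half_plane :: "complex set" where
  "upper_half_plane = {z. Im z > 0}"

definition cauchy_transform :: "real measure \<Rightarrow> complex \<Rightarrow> complex" where
  "cauchy_transform \<mu> z = (\<integral>x. 1 / (z - complex_of_real x) \<partial>\<mu>)"

definition F_transform :: "real measure \<Rightarrow> complex \<Rightarrow> complex" where
  "F_transform \<mu> z = 1 / cauchy_transform \<mu> z"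

definition K_transform :: "real measure \<Rightarrow> complex \<Rightarrow> complex" where
  "K_transform \<mu> z = z - F_transform \<mu> z"


section \<open>Orthogonal convolution\<close>

definition orth_conv :: "real measure \<Rightarrow> real measure \<Rightarrow> real measure" where
  "orth_conv \<mu> \<nu> = (THE \<rho>. real_distribution \<rho> \<and>
     (\<forall>z\<in>upper_half_plane.
        F_transform \<rho> z = F_transform \<mu> (F_transform \<nu> z) - F_transform \<nu> z + z))"

text \<open>The recursion is started at index 0 with the value \<open>\<mu>\<close>; this is only a convenient way of
  obtaining the two equations below, which are the definition for indices at least 1.\<close>

primrec orth_conv_iter :: "nat \<Rightarrow> real measure \<Rightarrow> real measure \<Rightarrow> real measure" where
  "orth_conv_iter 0 = (\<lambda>\<mu> \<nu>. \<mu>)"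
| "orth_conv_iter (Suc n) = (\<lambda>\<mu> \<nu>. orth_conv \<mu> (orth_conv_iter n \<nu> \<mu>))"

lemma orth_conv_iter_1: "orth_conv_iter 1 \<mu> \<nu> = orth_conv \<mu> \<nu>"
  by simp

lemma orth_conv_iter_rec:
  "n \<ge> 2 \<Longrightarrow> orth_conv_iter n \<mu> \<nu> = orth_conv \<mu> (orth_conv_iter (n - 1) \<nu> \<mu>)"
  by (cases n) simp_all


section \<open>C*-probability spaces and freeness\<close>

text \<open>A unital C*-algebra with a state, that is, a positive linear functional of norm one.
  The type classes provide a real unital Banach algebra; \<open>scaleC\<close> is the complex scalar
  multiplication extending the real one. That \<open>scaleC c\<close> scales the norm by \<open>\<bar>c\<bar>\<close> follows from the
  C*-identity.\<close>

locale cstar_probability_space = vector_space scaleC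
  for scaleC :: "complex \<Rightarrow> 'a::{real_normed_algebra_1, banach} \<Rightarrow> 'a" +
  fixes star :: "'a \<Rightarrow> 'a" and \<phi> :: "'a \<Rightarrow> complex"
  assumes scaleC_of_real: "scaleC (complex_of_real r) a = r *\<^sub>R a"
    and scaleC_mult_left: "scaleC c a * b = scaleC c (a * b)"
    and scaleC_mult_right: "a * scaleC c b = scaleC c (a * b)"
    and star_star: "star (star a) = a"
    and star_add: "star (a + b) = star a + star b"
    and star_scaleC: "star (scaleC c a) = scaleC (cnj c) (star a)"
    and star_mult: "star (a * b) = star b * star a"
    and cstar_identity: "norm (star a * a) = (norm a)\<^sup>2"
    and state_add: "\<phi> (a + b) = \<phi> a + \<phi> b"
    and state_scaleC: "\<phi> (scaleC c a) = c * \<phi> a"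
    and state_one: "\<phi> 1 = 1"
    and state_positive: "\<phi> (star a * a) \<in> \<real>\<^sub>\<ge>\<^sub>0"
    and state_norm: "norm (\<phi> a) \<le> norm a"

text \<open>A family \<open>A\<close> of unital subalgebras is free with respect to \<open>\<phi>\<close> if \<open>\<phi> (a\<^sub>1 \<dots> a\<^sub>n) = 0\<close>
  whenever \<open>n \<ge> 1\<close>, each \<open>a\<^sub>k\<close> is a centred element of the subalgebra with index \<open>i\<^sub>k\<close>, and
  neighbouring indices are distinct. The list \<open>ws\<close> consists of the pairs \<open>(i\<^sub>k, a\<^sub>k)\<close>.\<close>

definition free_subalgebras :: "('a::monoid_mult \<Rightarrow> complex) \<Rightarrow> ('i \<Rightarrow> 'a set) \<Rightarrow> bool" where
  "free_subalgebras \<phi> A \<longleftrightarrow>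
     (\<forall>ws :: ('i \<times> 'a) list.
        ws \<noteq> [] \<longrightarrow>
        (\<forall>(i, a)\<in>set ws. a \<in> A i \<and> \<phi> a = 0) \<longrightarrow>
        (\<forall>k. Suc k < length ws \<longrightarrow> fst (ws ! k) \<noteq> fst (ws ! Suc k)) \<longrightarrow>
        \<phi> (prod_list (map snd ws)) = 0)"

text \<open>The unital algebra generated by a single element is the span of its powers; for a
  self-adjoint element it is closed under the involution.\<close>

definition generated_algebra ::
    "(complex \<Rightarrow> 'a \<Rightarrow> 'a) \<Rightarrow> 'a::ring_1 \<Rightarrow> 'a set" where
  "generated_algebra scaleC X = module.span scaleC (range (\<lambda>n. X ^ n))"

definition free_pair ::
    "(complex \<Rightarrow> 'a \<Rightarrow> 'a) \<Rightarrow> ('a \<Rightarrow> complex) \<Rightarrow> 'a::ring_1 \<Rightarrow> 'a \<Rightarrow> bool" where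
  "free_pair scaleC \<phi> X Y \<longleftrightarrow>
     free_subalgebras \<phi> (\<lambda>i::bool. generated_algebra scaleC (if i then X else Y))"

text \<open>The distribution of a bounded self-adjoint random variable is the compactly supported
  probability measure with the same moments, which determine it uniquely.\<close>

definition has_distribution ::
    "('a::monoid_mult \<Rightarrow> complex) \<Rightarrow> 'a \<Rightarrow> real measure \<Rightarrow> bool" where
  "has_distribution \<phi> X \<mu> \<longleftrightarrow>
     real_distribution \<mu> \<and> compactly_supported \<mu> \<and>
     (\<forall>n. \<phi> (X ^ n) = complex_of_real (\<integral>x. x ^ n \<partial>\<mu>))"

end

theory Submission
  imports Defs "HOL-Complex_Analysis.Complex_Analysis"
begin

text \<open>
  Put \<open>f\<^sub>m = F(\<nu> \<turnstile>\<^sub>m \<mu>)\<close> and \<open>g\<^sub>m = F(\<mu> \<turnstile>\<^sub>m \<nu>)\<close>, where \<open>F(\<rho>)\<close> and \<open>K(\<rho>)\<close> are the reciprocal Cauchy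
  transform and the K-transform of \<open>\<rho>\<close>. The definition of the iterated orthogonal convolution says that
  \<open>f\<^sub>m\<^sub>+\<^sub>1(z) = z - K(\<nu>)(g\<^sub>m(z))\<close> and \<open>g\<^sub>m\<^sub>+\<^sub>1(z) = z - K(\<mu>)(f\<^sub>m(z))\<close>. Hence
  \<open>F(\<mu>)(f\<^sub>m(z)) = f\<^sub>m(z) + g\<^sub>m\<^sub>+\<^sub>1(z) - z\<close>, and the sum of the two K-transforms is \<open>2z - f\<^sub>m(z) - g\<^sub>m(z)\<close>.
  Both claims therefore amount to \<open>f\<^sub>m(z) + g\<^sub>m(z) \<longlonglongrightarrow> z + F(\<mu> \<boxplus> \<nu>)(z)\<close>, locally uniformly.

  If \<open>Im z\<close> is large, the recursion is a contraction, because the K-transform of a compactly supported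
  measure has small derivative far from the real line. So \<open>f\<^sub>m(z)\<close> and \<open>g\<^sub>m(z)\<close> converge to numbers
  \<open>a\<close> and \<open>b\<close> with \<open>F(\<mu>)(a) = F(\<nu>)(b) = a + b - z\<close>. Equivalently, the resolvents \<open>(a - X\<^sub>1)\<^sup>-\<^sup>1\<close> and
  \<open>(b - X\<^sub>2)\<^sup>-\<^sup>1\<close> have the same expectation \<open>g\<close>, and \<open>z = a + b - 1/g\<close>. An algebraic identity of Haagerup
  writes \<open>(z - X\<^sub>1 - X\<^sub>2)\<^sup>-\<^sup>1\<close> as a geometric series in the centred resolvents, and freeness annihilates
  all its terms but one, whose expectation is \<open>g\<close> (\<open>state_resolvent_free_sum\<close>). Thus \<open>a + b - z\<close> is
  \<open>F(\<mu> \<boxplus> \<nu>)(z)\<close>; this is \<open>subordination_at_infinity\<close>.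

  The passage from large \<open>Im z\<close> to the whole half-plane is Vitali's theorem. Its boundedness hypothesis
  holds because \<open>Im F(\<rho>)(z) \<ge> Im z\<close> for every \<open>\<rho>\<close>, so that a bound \<open>C + D / Im w\<close> on \<open>K(\<mu>)(w)\<close> bounds all
  the iterates at once.

  What remains is that the recursion is available at all: \<open>orth_conv\<close> is a definite description, so it
  has the intended transform only if a measure with this transform exists and is unique. Uniqueness is
  \<open>cauchy_transform_unique\<close>. Existence (\<open>exists_distribution\<close>) is Stieltjes inversion: a map \<open>f\<close> of the
  half-plane that raises imaginary parts and stays near the identity is the reciprocal Cauchy transform
  of the weak limit of the densities \<open>- Im (1 / f(x + iy)) / \<pi>\<close> as \<open>y\<close> tends to \<open>0\<close>.
\<close>

section \<open>Reciprocal Cauchy transforms on the upper half-plane\<close>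

lemma Im_le_norm_diff: "Im z \<le> norm (z - complex_of_real x)"
  using abs_Im_le_cmod[of "z - complex_of_real x"] by simp

lemma upper_half_plane_iff: "z \<in> upper_half_plane \<longleftrightarrow> Im z > 0"
  by (simp add: upper_half_plane_def)

lemma open_upper_half_plane: "open upper_half_plane"
  unfolding upper_half_plane_def by (rule open_halfspace_Im_gt)

lemma convex_upper_half_plane: "convex upper_half_plane"
  unfolding upper_half_plane_def by (rule convex_halfspace_Im_gt)

lemma norm_resolvent_le:
  assumes "Im z > 0"
  shows "norm (1 / (z - complex_of_real x)) \<le> 1 / Im z"
  using Im_le_norm_diff[of z x] assms by (simp add: norm_divide frac_le)

lemma upper_half_plane_diff_neq_0: "Im z > 0 \<Longrightarrow> z - complex_of_real x \<noteq> 0"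
  by (auto simp: complex_eq_iff)

context real_distribution
begin

lemma integrable_bounded_borel:
  fixes f :: "real \<Rightarrow> 'b::{banach, second_countable_topology}"
  assumes "f \<in> borel_measurable borel" "\<And>x. norm (f x) \<le> B"
  shows "integrable M f"
  using assms by (intro integrable_const_bound[of _ B]) auto

lemma integrable_resolvent:
  assumes "Im z > 0"
  shows "integrable M (\<lambda>x. 1 / (z - complex_of_real x))"
  by (rule integrable_bounded_borel[OF _ norm_resolvent_le[OF assms]]) simp

lemma Im_resolvent:
  "Im (1 / (z - complex_of_real x)) = - Im z * (norm (1 / (z - complex_of_real x)))\<^sup>2"
  by (simp add: Im_divide norm_divide power_divide cmod_power2)

lemma integrable_norm_resolvent_sq:
  assumes "Im z > 0"
  shows "integrable M (\<lambda>x. (norm (1 / (z - complex_of_real x)))\<^sup>2)"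
  by (rule integrable_bounded_borel[of _ "(1 / Im z)\<^sup>2"])
     (use norm_resolvent_le[OF assms] assms in \<open>auto intro!: power_mono\<close>)

lemma Im_cauchy_transform:
  assumes "Im z > 0"
  shows "Im (cauchy_transform M z) = - Im z * (\<integral>x. (norm (1 / (z - complex_of_real x)))\<^sup>2 \<partial>M)"
  unfolding cauchy_transform_def
  by (subst integral_Im[symmetric, OF integrable_resolvent[OF assms]])
     (simp only: Im_resolvent integral_mult_right_zero)

text \<open>The variance of \<open>x \<mapsto> \<bar>1 / (z - x)\<bar>\<close> is nonnegative. As the imaginary part of the Cauchy transform is
  \<open>- Im z\<close> times the second moment of this function, the bound is exactly what makes \<open>F_transform\<close> raise
  imaginary parts.\<close>

lemma norm_cauchy_transform_sq_le:
  assumes "Im z > 0"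
  shows "(norm (cauchy_transform M z))\<^sup>2 \<le> (\<integral>x. (norm (1 / (z - complex_of_real x)))\<^sup>2 \<partial>M)"
proof -
  let ?n = "\<lambda>x. norm (1 / (z - complex_of_real x))"
  have int: "integrable M ?n"
    using integrable_resolvent[OF assms] by (rule integrable_norm)
  have "norm (cauchy_transform M z) \<le> (\<integral>x. ?n x \<partial>M)"
    unfolding cauchy_transform_def by (rule integral_norm_bound)
  then have "(norm (cauchy_transform M z))\<^sup>2 \<le> (\<integral>x. ?n x \<partial>M)\<^sup>2"
    by (intro power_mono) auto
  also have "\<dots> \<le> (\<integral>x. (?n x)\<^sup>2 \<partial>M)"
    using variance_positive[of ?n] variance_eq[OF int integrable_norm_resolvent_sq[OF assms]] by simp
  finally show ?thesis .
qed

lemma integral_norm_resolvent_sq_pos: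
  assumes "Im z > 0"
  shows "(\<integral>x. (norm (1 / (z - complex_of_real x)))\<^sup>2 \<partial>M) > 0"
proof -
  have "(\<integral>x. (norm (1 / (z - complex_of_real x)))\<^sup>2 \<partial>M) > (\<integral>x. 0 \<partial>M)"
    by (rule integral_less_AE_space)
       (use integrable_norm_resolvent_sq[OF assms] upper_half_plane_diff_neq_0[OF assms]
         emeasure_space_1 in auto)
  then show ?thesis by simp
qed

lemma Im_cauchy_transform_neg: "Im z > 0 \<Longrightarrow> Im (cauchy_transform M z) < 0"
  using Im_cauchy_transform integral_norm_resolvent_sq_pos by (simp add: mult_pos_pos)

lemma cauchy_transform_neq_0: "Im z > 0 \<Longrightarrow> cauchy_transform M z \<noteq> 0"
  using Im_cauchy_transform_neg by fastforce

lemma Im_F_transform_ge: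
  assumes "Im z > 0"
  shows "Im (F_transform M z) \<ge> Im z"
proof -
  define I where "I = (\<integral>x. (norm (1 / (z - complex_of_real x)))\<^sup>2 \<partial>M)"
  define G where "G = cauchy_transform M z"
  have "(norm G)\<^sup>2 > 0" using cauchy_transform_neq_0[OF assms] by (simp add: G_def)
  moreover have "Im G = - Im z * I" "(norm G)\<^sup>2 \<le> I"
    using Im_cauchy_transform norm_cauchy_transform_sq_le assms by (auto simp: G_def I_def)
  moreover have "Im (F_transform M z) = - Im G / (norm G)\<^sup>2"
    by (simp add: F_transform_def G_def Im_divide cmod_power2)
  ultimately show ?thesis
    using assms by (simp add: pos_le_divide_eq)
qed

text \<open>By the resolvent identity, the difference quotient differs from the candidate derivative by \<open>w - z\<close>
  times an integral that is bounded for \<open>w\<close> near \<open>z\<close>.\<close>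

lemma cauchy_transform_has_field_derivative:
  assumes z: "Im z > 0"
  shows "(cauchy_transform M has_field_derivative
     - (\<integral>x. (1 / (z - complex_of_real x))\<^sup>2 \<partial>M)) (at z)"
proof -
  let ?r = "\<lambda>z x. 1 / (z - complex_of_real x)"
  define D where "D = - (\<integral>x. (?r z x)\<^sup>2 \<partial>M)"
  have bound: "norm ((cauchy_transform M w - cauchy_transform M z) / (w - z) - D)
      \<le> norm (w - z) * (1 / (Im z / 2) * (1 / Im z)\<^sup>2)"
    if w: "Im w > Im z / 2" "w \<noteq> z" for w
  proof -
    have w0: "Im w > 0" using w z by simp
    have eq: "(?r w x - ?r z x) / (w - z) + (?r z x)\<^sup>2 = (w - z) * (?r w x * (?r z x)\<^sup>2)" for x
    proof -
      define a b where "a = w - complex_of_real x" and "b = z - complex_of_real x"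
      have nz: "a \<noteq> 0" "b \<noteq> 0" "a - b \<noteq> 0" and wz: "a - b = w - z"
        using upper_half_plane_diff_neq_0 w0 z w by (auto simp: a_def b_def)
      have "(1 / a - 1 / b) / (a - b) + (1 / b)\<^sup>2 = (a - b) * (1 / a * (1 / b)\<^sup>2)"
        using nz by (simp add: field_simps power2_eq_square)
      then show ?thesis unfolding wz unfolding a_def b_def .
    qed
    have i1: "integrable M (\<lambda>x. (?r w x - ?r z x) / (w - z))"
      by (intro integrable_divide_zero Bochner_Integration.integrable_diff integrable_resolvent w0 z impI)
    have i2: "integrable M (\<lambda>x. (?r z x)\<^sup>2)"
      by (rule integrable_bounded_borel[of _ "(1 / Im z)\<^sup>2"])
         (use norm_resolvent_le[OF z] z in \<open>auto intro!: power_mono simp: norm_power simp del: norm_divide\<close>)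
    have quot: "(cauchy_transform M w - cauchy_transform M z) / (w - z) - D
       = (\<integral>x. (w - z) * (?r w x * (?r z x)\<^sup>2) \<partial>M)"
      unfolding eq[symmetric] Bochner_Integration.integral_add[OF i1 i2] cauchy_transform_def D_def
      using Bochner_Integration.integral_diff[OF integrable_resolvent[OF w0] integrable_resolvent[OF z]]
      by (simp add: integral_divide_zero)
    have le: "norm ((w - z) * (?r w x * (?r z x)\<^sup>2)) \<le> norm (w - z) * (1 / (Im z / 2) * (1 / Im z)\<^sup>2)" for x
    proof -
      have "1 / Im w \<le> 1 / (Im z / 2)"
        using w z by (intro frac_le) auto
      then have "norm (?r w x) \<le> 1 / (Im z / 2)"
        using norm_resolvent_le[OF w0, of x] by linarith
      moreover have "(norm (?r z x))\<^sup>2 \<le> (1 / Im z)\<^sup>2"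
        using norm_resolvent_le[OF z, of x] by (intro power_mono) auto
      ultimately have "norm (?r w x) * (norm (?r z x))\<^sup>2 \<le> (1 / (Im z / 2)) * (1 / Im z)\<^sup>2"
        using z by (intro mult_mono) auto
      then show ?thesis
        unfolding norm_mult norm_power by (rule mult_left_mono) simp
    qed
    have "norm (\<integral>x. (w - z) * (?r w x * (?r z x)\<^sup>2) \<partial>M) \<le> (\<integral>x. norm ((w - z) * (?r w x * (?r z x)\<^sup>2)) \<partial>M)"
      by (rule integral_norm_bound)
    also have "\<dots> \<le> (\<integral>x. norm (w - z) * (1 / (Im z / 2) * (1 / Im z)\<^sup>2) \<partial>M)"
    proof (rule integral_mono)
      show "integrable M (\<lambda>x. norm ((w - z) * (?r w x * (?r z x)\<^sup>2)))"
        by (rule integrable_bounded_borel[of _ "norm (w - z) * (1 / (Im z / 2) * (1 / Im z)\<^sup>2)"])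
           (measurable, use le in simp)
      show "norm ((w - z) * (?r w x * (?r z x)\<^sup>2)) \<le> norm (w - z) * (1 / (Im z / 2) * (1 / Im z)\<^sup>2)" for x
        by (rule le)
    qed simp
    also have "\<dots> = norm (w - z) * (1 / (Im z / 2) * (1 / Im z)\<^sup>2)"
      by (simp only: lebesgue_integral_const prob_space) simp
    finally show ?thesis unfolding quot .
  qed
  have "((\<lambda>w. (cauchy_transform M w - cauchy_transform M z) / (w - z) - D) \<longlongrightarrow> 0) (at z)"
  proof (rule Lim_null_comparison)
    have "open {w. Im w > Im z / 2}" "z \<in> {w. Im w > Im z / 2}"
      using z open_halfspace_Im_gt[of "Im z / 2"] by auto
    then have "\<forall>\<^sub>F w in at z. w \<in> {w. Im w > Im z / 2}" 
      by (rule eventually_at_in_open')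
    moreover have "\<forall>\<^sub>F w in at z. w \<noteq> z" by (rule eventually_neq_at_within)
    ultimately show "\<forall>\<^sub>F w in at z. norm ((cauchy_transform M w - cauchy_transform M z) / (w - z) - D)
      \<le> norm (w - z) * (1 / (Im z / 2) * (1 / Im z)\<^sup>2)"
      by eventually_elim (use bound in auto)
    show "((\<lambda>w. norm (w - z) * (1 / (Im z / 2) * (1 / Im z)\<^sup>2)) \<longlongrightarrow> 0) (at z)"
      by (intro tendsto_mult_left_zero tendsto_norm_zero) (simp add: LIM_zero)
  qed
  then show ?thesis
    unfolding D_def[symmetric] has_field_derivative_iff by (rule LIM_zero_cancel)
qed

lemma holomorphic_cauchy_transform: "cauchy_transform M holomorphic_on upper_half_plane"
  unfolding holomorphic_on_open[OF open_upper_half_plane]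
  using cauchy_transform_has_field_derivative upper_half_plane_iff by blast

lemma holomorphic_F_transform: "F_transform M holomorphic_on upper_half_plane"
  unfolding F_transform_def
  by (intro holomorphic_intros holomorphic_cauchy_transform)
     (use cauchy_transform_neq_0 in \<open>auto simp: upper_half_plane_iff\<close>)

lemma F_transform_in_upper_half_plane:
  "z \<in> upper_half_plane \<Longrightarrow> F_transform M z \<in> upper_half_plane"
  using Im_F_transform_ge[of z] by (simp add: upper_half_plane_iff)

end


section \<open>Injectivity of the Cauchy transform\<close>

lemma integrable_poisson: "integrable lborel (\<lambda>u::real. 1 / (1 + u\<^sup>2))"
  using integrable_inverse_1_plus_square
  by (simp add: set_integrable_def interval_lebesgue_integral_def inverse_eq_divide)

lemma integral_poisson_pos: "(\<integral>u. 1 / (1 + u\<^sup>2) \<partial>lborel) > (0::real)"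
  using LBINT_inverse_1_plus_square
  by (simp add: interval_lebesgue_integral_def set_lebesgue_integral_def inverse_eq_divide)

text \<open>The imaginary part of the Cauchy transform on the line at height \<open>y\<close> is, up to the sign and the factor
  \<open>\<pi>\<close>, the density of the convolution of the measure with a Cauchy distribution of scale \<open>y\<close>. Its Fourier
  transform is the product of the two characteristic functions, so the characteristic function of the
  measure can be read off wherever the other factor does not vanish.\<close>

definition poisson_kernel :: "real \<Rightarrow> real \<Rightarrow> real" where
  "poisson_kernel y u = y / (y\<^sup>2 + u\<^sup>2)"

lemma poisson_kernel_measurable [measurable]: "poisson_kernel y \<in> borel_measurable borel"
  unfolding poisson_kernel_def by measurable

lemma poisson_kernel_nonneg: "y > 0 \<Longrightarrow> poisson_kernel y u \<ge> 0"
  by (simp add: poisson_kernel_def)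

lemma poisson_kernel_scale: "y > 0 \<Longrightarrow> y * poisson_kernel y (y * v) = 1 / (1 + v\<^sup>2)"
proof -
  have "y\<^sup>2 + (y * v)\<^sup>2 = y * y * (1 + v\<^sup>2)" by algebra
  then show "y > 0 \<Longrightarrow> ?thesis" by (simp add: poisson_kernel_def)
qed

lemma integrable_poisson_kernel:
  assumes "y > 0"
  shows "integrable lborel (poisson_kernel y)"
proof -
  have "poisson_kernel y (0 + y * v) = 1 / y * (1 / (1 + v\<^sup>2))" for v
    unfolding poisson_kernel_scale[OF assms, symmetric] using assms by simp
  then have "integrable lborel (\<lambda>v. poisson_kernel y (0 + y * v))"
    using integrable_mult_right[OF integrable_poisson, of "1/y"] by presburger
  then show ?thesis
    using lborel_integrable_real_affine_iff[of y "poisson_kernel y" 0] assms by simp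
qed

lemma norm_iexp [simp]: "norm (iexp (x::real)) = 1"
  by (rule norm_exp_i_times)

lemma integrable_iexp_mult:
  fixes h :: "real \<Rightarrow> real"
  assumes "integrable lborel h"
  shows "integrable lborel (\<lambda>u. iexp (s * u) * complex_of_real (h u))"
  by (rule Bochner_Integration.integrable_bound[OF assms])
     (use assms in \<open>auto simp: norm_mult\<close>)

definition poisson_char :: "real \<Rightarrow> real \<Rightarrow> complex" where
  "poisson_char y s = (\<integral>u. iexp (s * u) * complex_of_real (poisson_kernel y u) \<partial>lborel)"

text \<open>Only the positivity of the limit matters: it shows that for each \<open>s\<close> the factor \<open>poisson_char y s\<close> is
  nonzero for small \<open>y\<close>. After the substitution \<open>u = y v\<close> the parameter sits only in the oscillating
  factor, and dominated convergence applies.\<close>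

lemma poisson_char_tendsto:
  "(\<lambda>n. poisson_char (1 / real (Suc n)) s) \<longlonglongrightarrow> complex_of_real (\<integral>u. 1 / (1 + u\<^sup>2) \<partial>lborel)"
proof -
  have scale: "poisson_char y s = (\<integral>v. iexp (s * (y * v)) * complex_of_real (1 / (1 + v\<^sup>2)) \<partial>lborel)"
    if "y > 0" for y
  proof -
    have "poisson_char y s = \<bar>y\<bar> *\<^sub>R (\<integral>v. iexp (s * (0 + y * v)) * complex_of_real (poisson_kernel y (0 + y * v)) \<partial>lborel)"
      unfolding poisson_char_def by (rule lborel_integral_real_affine) (use that in simp)
    also have "\<dots> = (\<integral>v. y *\<^sub>R (iexp (s * (0 + y * v)) * complex_of_real (poisson_kernel y (0 + y * v))) \<partial>lborel)"
      using that by simp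
    also have "\<dots> = (\<integral>v. iexp (s * (y * v)) * complex_of_real (1 / (1 + v\<^sup>2)) \<partial>lborel)"
      unfolding poisson_kernel_scale[OF that, symmetric] by (simp add: scaleR_conv_of_real mult_ac)
    finally show ?thesis .
  qed
  have "(\<lambda>n. \<integral>v. iexp (s * (1 / real (Suc n) * v)) * complex_of_real (1 / (1 + v\<^sup>2)) \<partial>lborel)
      \<longlonglongrightarrow> (\<integral>v. complex_of_real (1 / (1 + v\<^sup>2)) \<partial>lborel)"
  proof (rule integral_dominated_convergence[where w = "\<lambda>v. 1 / (1 + v\<^sup>2)"])
    show "AE v in lborel. (\<lambda>n. iexp (s * (1 / real (Suc n) * v)) * complex_of_real (1 / (1 + v\<^sup>2)))
      \<longlonglongrightarrow> complex_of_real (1 / (1 + v\<^sup>2))"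
    proof (rule AE_I2)
      fix v :: real
      have lim: "(\<lambda>n. 1 / real (Suc n)) \<longlonglongrightarrow> 0"
        by (rule LIMSEQ_Suc[OF lim_1_over_n])
      then have "(\<lambda>n. iexp (s * (1 / real (Suc n) * v)) * complex_of_real (1 / (1 + v\<^sup>2)))
          \<longlonglongrightarrow> iexp (s * (0 * v)) * complex_of_real (1 / (1 + v\<^sup>2))"
        by (intro lim tendsto_intros)
      then show "(\<lambda>n. iexp (s * (1 / real (Suc n) * v)) * complex_of_real (1 / (1 + v\<^sup>2)))
          \<longlonglongrightarrow> complex_of_real (1 / (1 + v\<^sup>2))" by simp
    qed
  qed (use integrable_poisson in \<open>auto simp: norm_mult norm_divide abs_of_nonneg simp flip: of_real_power of_real_add intro!: AE_I2\<close>)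
  moreover have "poisson_char (1 / real (Suc n)) s
      = (\<integral>v. iexp (s * (1 / real (Suc n) * v)) * complex_of_real (1 / (1 + v\<^sup>2)) \<partial>lborel)" for n
    by (rule scale) simp
  ultimately show ?thesis
    by (simp only: integral_complex_of_real)
qed

context real_distribution
begin

lemma Im_cauchy_transform_poisson:
  assumes "y > 0"
  shows "- Im (cauchy_transform M (Complex t y)) = (\<integral>x. poisson_kernel y (t - x) \<partial>M)"
proof -
  have "- Im (cauchy_transform M (Complex t y)) = (\<integral>x. - Im (1 / (Complex t y - complex_of_real x)) \<partial>M)"
    unfolding cauchy_transform_def
    using integral_Im[OF integrable_resolvent[of "Complex t y"]] assms
    by simp
  also have "\<dots> = (\<integral>x. poisson_kernel y (t - x) \<partial>M)"
    by (simp add: Im_divide poisson_kernel_def add.commute)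
  finally show ?thesis .
qed

lemma char_mult_poisson_char:
  assumes y: "y > 0"
  shows "(\<integral>t. iexp (s * t) * complex_of_real (- Im (cauchy_transform M (Complex t y))) \<partial>lborel)
    = char M s * poisson_char y s"
proof -
  interpret pair_sigma_finite M lborel ..
  define f where "f = (\<lambda>(x, t). iexp (s * t) * complex_of_real (poisson_kernel y (t - x)))"
  have shift: "(\<integral>t. h t \<partial>lborel) = (\<integral>t. h (x + t) \<partial>lborel)" for h :: "real \<Rightarrow> complex" and x
    using lborel_integral_real_affine[of 1 h x] by simp
  have shiftr: "(\<integral>t. h t \<partial>lborel) = (\<integral>t. h (x + t) \<partial>lborel)" for h :: "real \<Rightarrow> real" and x
    using lborel_integral_real_affine[of 1 h x] by simp
  have int: "integrable lborel (\<lambda>t. poisson_kernel y (t - x))" for x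
    using lborel_integrable_real_affine[OF integrable_poisson_kernel[OF y], of 1 "-x"] by simp
  have [measurable]: "f \<in> borel_measurable (M \<Otimes>\<^sub>M lborel)"
    unfolding f_def poisson_kernel_def by measurable
  have "integrable (M \<Otimes>\<^sub>M lborel) f"
  proof (rule Fubini_integrable)
    have "(\<integral>t. norm (f (x, t)) \<partial>lborel) = (\<integral>t. poisson_kernel y t \<partial>lborel)" for x
      using shiftr[of "\<lambda>t. poisson_kernel y (t - x)" x] poisson_kernel_nonneg[OF y]
      by (simp add: f_def norm_mult)
    then show "integrable M (\<lambda>x. \<integral>t. norm (f (x, t)) \<partial>lborel)"
      by simp
    show "AE x in M. integrable lborel (\<lambda>t. f (x, t))"
      unfolding f_def using integrable_iexp_mult[OF int] by simp
  qed measurable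
  then have fub: "(\<integral>t. (\<integral>x. f (x, t) \<partial>M) \<partial>lborel) = (\<integral>x. (\<integral>t. f (x, t) \<partial>lborel) \<partial>M)"
    using Fubini_integral[of "\<lambda>x t. f (x, t)"] by simp
  have "(\<integral>x. f (x, t) \<partial>M) = iexp (s * t) * complex_of_real (- Im (cauchy_transform M (Complex t y)))" for t
    unfolding f_def Im_cauchy_transform_poisson[OF y] by (simp add: integral_complex_of_real)
  moreover have "(\<integral>t. f (x, t) \<partial>lborel) = iexp (s * x) * poisson_char y s" for x
  proof -
    have "(\<integral>t. f (x, t) \<partial>lborel) = (\<integral>t. iexp (s * x) * (iexp (s * t) * complex_of_real (poisson_kernel y t)) \<partial>lborel)"
      unfolding f_def
      by (subst shift[of _ x]) (simp add: exp_add algebra_simps)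
    then show ?thesis by (simp add: poisson_char_def)
  qed
  ultimately show ?thesis
    using fub by (simp add: char_def)
qed

end

theorem cauchy_transform_unique:
  assumes "real_distribution M" "real_distribution N"
    and eq: "\<And>z. z \<in> upper_half_plane \<Longrightarrow> cauchy_transform M z = cauchy_transform N z"
  shows "M = N"
proof (rule Levy_uniqueness[OF assms(1,2)], rule ext)
  fix s
  interpret M: real_distribution M by fact
  interpret N: real_distribution N by fact
  have "char M s * poisson_char y s = char N s * poisson_char y s" if "y > 0" for y
    using M.char_mult_poisson_char[OF that, of s] N.char_mult_poisson_char[OF that, of s]
      eq[of "Complex _ y"] that by (simp add: upper_half_plane_iff)
  then have eq_seq: "(\<lambda>n. char M s * poisson_char (1 / real (Suc n)) s) = (\<lambda>n. char N s * poisson_char (1 / real (Suc n)) s)"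
    by auto
  have lim: "(\<lambda>n. c * poisson_char (1 / real (Suc n)) s) \<longlonglongrightarrow> c * complex_of_real (\<integral>u. 1 / (1 + u\<^sup>2) \<partial>lborel)" for c
    by (intro tendsto_intros poisson_char_tendsto)
  have "char M s * complex_of_real (\<integral>u. 1 / (1 + u\<^sup>2) \<partial>lborel) = char N s * complex_of_real (\<integral>u. 1 / (1 + u\<^sup>2) \<partial>lborel)"
    by (rule LIMSEQ_unique[OF lim[of "char M s"] lim[of "char N s", folded eq_seq]])
  then show "char M s = char N s"
    using integral_poisson_pos by simp
qed

corollary F_transform_unique:
  assumes "real_distribution M" "real_distribution N"
    and "\<And>z. z \<in> upper_half_plane \<Longrightarrow> F_transform M z = F_transform N z"
  shows "M = N"
  using assms(3) by (intro cauchy_transform_unique[OF assms(1,2)]) (simp add: F_transform_def)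


section \<open>Cauchy integrals along the real line\<close>

text \<open>This absorbs the pole into the decay of the numerator, so that the Cauchy integrand is \<open>O(1 / (1 + x\<^sup>2))\<close>
  along the whole line.\<close>

lemma norm_diff_real_ge:
  assumes "Im q \<noteq> 0"
  shows "1 + \<bar>x\<bar> \<le> (1 + (1 + norm q) / \<bar>Im q\<bar>) * norm (complex_of_real x - q)"
proof -
  have "\<bar>Im q\<bar> \<le> norm (complex_of_real x - q)"
    using abs_Im_le_cmod[of "complex_of_real x - q"] by simp
  then have "1 \<le> norm (complex_of_real x - q) / \<bar>Im q\<bar>"
    using assms by simp
  then have "(1 + norm q) * 1 \<le> (1 + norm q) * (norm (complex_of_real x - q) / \<bar>Im q\<bar>)"
    by (intro mult_left_mono) auto
  moreover have "\<bar>x\<bar> \<le> norm (complex_of_real x - q) + norm q"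
    using norm_triangle_ineq[of "complex_of_real x - q" q] by simp
  ultimately show ?thesis
    by (simp add: algebra_simps)
qed

text \<open>Close the segment from \<open>-R\<close> to \<open>R\<close> to a rectangle in the upper half-plane. The other three sides have length
  \<open>O(R)\<close> and the integrand is \<open>O(1 / R\<^sup>2)\<close> there, so their contribution vanishes in the limit, and the line
  integral is given by Cauchy's formula or by Cauchy's theorem according to the position of the pole. Both
  cases are needed: a reflected pole in the lower half-plane is what turns a formula for \<open>h\<close> into one
  for \<open>Im h\<close>.\<close>

lemma
  fixes h :: "complex \<Rightarrow> complex" and q :: complex
  assumes \<delta>: "\<delta> > 0" and hol: "h holomorphic_on {w. Im w > - \<delta>}"
    and decay: "\<And>w. Im w \<ge> 0 \<Longrightarrow> norm (h w) * (1 + norm w) \<le> B"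
    and q: "Im q \<noteq> 0"
  shows integrable_real_line: "integrable lborel (\<lambda>x. h (complex_of_real x) / (complex_of_real x - q))"
    and cauchy_integral_real_line:
      "(\<integral>x. h (complex_of_real x) / (complex_of_real x - q) \<partial>lborel)
        = (if Im q > 0 then 2 * pi * \<i> * h q else 0)"
proof -
  define g where "g = (\<lambda>w. h w / (w - q))"
  define L where "L = (if Im q > 0 then 2 * pi * \<i> * h q else 0)"
  define S where "S = {w. Im w > - \<delta>}"
  have S: "open S" "convex S"
    unfolding S_def by (rule open_halfspace_Im_gt convex_halfspace_Im_gt)+
  have B: "B \<ge> 0"
    by (rule order_trans[OF _ decay[of 0]]) simp_all
  have gcont: "continuous_on (S - {q}) g"
    unfolding g_def using holomorphic_on_imp_continuous_on[OF hol]
    by (intro continuous_intros) (auto intro: continuous_on_subset simp: S_def)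
  have gcont_real: "continuous_on A (\<lambda>x. g (complex_of_real x))" for A
    using q by (intro continuous_on_compose2[OF gcont] continuous_intros) (auto simp: S_def \<delta>)
  then have [measurable]: "(\<lambda>x. g (complex_of_real x)) \<in> borel_measurable borel"
    by (rule borel_measurable_continuous_onI)
  have bound_real: "norm (g (complex_of_real x)) \<le> B * (1 + (1 + norm q) / \<bar>Im q\<bar>) * (1 / (1 + x\<^sup>2))" for x
  proof -
    define c where "c = 1 + (1 + norm q) / \<bar>Im q\<bar>"
    have d: "norm (complex_of_real x - q) > 0" using q by auto
    have c: "1 + \<bar>x\<bar> \<le> c * norm (complex_of_real x - q)"
      using norm_diff_real_ge[OF q, of x] by (simp add: c_def)
    have "norm (g (complex_of_real x)) * (1 + x\<^sup>2) \<le> norm (g (complex_of_real x)) * ((1 + \<bar>x\<bar>) * (1 + \<bar>x\<bar>))"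
      by (intro mult_left_mono) (auto simp: algebra_simps power2_eq_square)
    also have "\<dots> = (norm (h (complex_of_real x)) * (1 + \<bar>x\<bar>)) * ((1 + \<bar>x\<bar>) / norm (complex_of_real x - q))"
      by (simp add: g_def norm_divide)
    also have "\<dots> \<le> B * c"
      using decay[of "complex_of_real x"] c d B by (intro mult_mono) (auto simp: pos_divide_le_eq)
    finally show ?thesis
      by (simp add: c_def[symmetric] pos_le_divide_eq add_pos_nonneg)
  qed
  have int: "integrable lborel (\<lambda>x. g (complex_of_real x))"
    by (rule Bochner_Integration.integrable_bound[OF integrable_mult_right[OF integrable_poisson, of "B * (1 + (1 + norm q) / \<bar>Im q\<bar>)"]])
       (auto intro!: AE_I2 order_trans[OF bound_real abs_ge_self] simp del: times_divide_eq_right)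
  then show "integrable lborel (\<lambda>x. h (complex_of_real x) / (complex_of_real x - q))"
    by (simp add: g_def)
  have rect: "norm (integral {-R..R} (\<lambda>x. g (complex_of_real x)) - L) \<le> 8 * B / R"
    if R: "R > 2 * norm q" "R > 0" for R
  proof -
    define a b c d where "a = complex_of_real (-R)" and "b = complex_of_real R"
      and "c = Complex R R" and "d = Complex (-R) R"
    have ReIm: "\<bar>Re q\<bar> < R" "\<bar>Im q\<bar> < R"
      using abs_Re_le_cmod[of q] abs_Im_le_cmod[of q] R by auto
    have rp: "rectpath a c = linepath a b +++ linepath b c +++ linepath c d +++ linepath d a"
      by (simp add: rectpath_def a_def b_def c_def d_def Let_def complex_of_real_def)
    have img: "path_image (rectpath a c) = {w. Re w \<in> {-R, R} \<and> Im w \<in> {0..R}} \<union> {w. Im w \<in> {0, R} \<and> Re w \<in> {-R..R}}"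
      using R by (subst path_image_rectpath) (auto simp: a_def c_def)
    have img_S: "path_image (rectpath a c) \<subseteq> S - {q}"
      unfolding img using \<delta> q ReIm R by (auto simp: S_def)
    have total: "(g has_contour_integral L) (rectpath a c)"
    proof (cases "Im q > 0")
      case True
      have "winding_number (rectpath a c) q = 1"
        using True ReIm by (intro winding_number_rectpath) (auto simp: in_box_complex_iff a_def c_def)
      moreover have "((\<lambda>w. h w / (w - q)) has_contour_integral (2*pi * \<i> * winding_number (rectpath a c) q * h q)) (rectpath a c)"
        using img_S S hol True \<delta>
        by (intro Cauchy_integral_formula_convex_simple[of S]) (auto simp: interior_open S_def[symmetric], auto simp: S_def)
      ultimately show ?thesis
        using True by (simp add: g_def L_def)
    next
      case False
      \<comment> \<open>The pole lies below the path, and a slightly smaller half-plane avoids it.\<close>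
      define T where "T = {w. Im w > max (- \<delta>) (Im q)}"
      have "g holomorphic_on T"
        unfolding g_def by (intro holomorphic_intros holomorphic_on_subset[OF hol]) (auto simp: T_def)
      moreover have "convex T"
        unfolding T_def by (rule convex_halfspace_Im_gt)
      moreover have "path_image (rectpath a c) \<subseteq> T"
        unfolding img using \<delta> q False R by (auto simp: T_def)
      ultimately have "(g has_contour_integral 0) (rectpath a c)"
        by (intro Cauchy_theorem_convex_simple[of _ T]) auto
      then show ?thesis using False by (simp add: L_def)
    qed
    have segs: "closed_segment a b \<subseteq> path_image (rectpath a c)" "closed_segment b c \<subseteq> path_image (rectpath a c)"
      "closed_segment c d \<subseteq> path_image (rectpath a c)" "closed_segment d a \<subseteq> path_image (rectpath a c)"
      unfolding rp by (auto simp: path_image_join)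
    have integ: "g contour_integrable_on linepath u v" if "closed_segment u v \<subseteq> path_image (rectpath a c)" for u v
      by (rule contour_integrable_continuous_linepath, rule continuous_on_subset[OF gcont])
         (use that img_S in blast)
    have far: "norm (contour_integral (linepath u v) g) \<le> (2 * B / R / R) * norm (v - u)"
      if "closed_segment u v \<subseteq> path_image (rectpath a c)" "\<And>w. w \<in> closed_segment u v \<Longrightarrow> R \<le> norm w" for u v
    proof (rule contour_integral_bound_linepath[OF integ[OF that(1)]])
      fix w assume w: "w \<in> closed_segment u v"
      then have wR: "R \<le> norm w" and Im: "Im w \<ge> 0"
        using that img R by auto
      have "norm (h w) * R \<le> norm (h w) * (1 + norm w)"
        using wR by (intro mult_left_mono) auto
      then have hw: "norm (h w) \<le> B / R"
        using decay[OF Im] R by (simp add: pos_le_divide_eq)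
      have "norm (w - q) \<ge> R / 2"
        using norm_triangle_ineq2[of w q] wR R by linarith
      then have "norm (g w) \<le> (B / R) / (R / 2)"
        unfolding g_def norm_divide using hw R B by (intro frac_le) auto
      then show "norm (g w) \<le> 2 * B / R / R" using R by (simp add: field_simps)
    qed (use B R in auto)
    have far_b: "R \<le> norm w" if "w \<in> closed_segment b c" for w
      using that abs_Re_le_cmod[of w] by (auto simp: closed_segment_same_Re b_def c_def)
    have far_c: "R \<le> norm w" if "w \<in> closed_segment c d" for w
      using that abs_Im_le_cmod[of w] by (auto simp: closed_segment_same_Im d_def c_def)
    have far_d: "R \<le> norm w" if "w \<in> closed_segment d a" for w
      using that abs_Re_le_cmod[of w] by (auto simp: closed_segment_same_Re d_def a_def)
    have lens: "norm (c - b) = R" "norm (d - c) = 2 * R" "norm (a - d) = R"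
      using R by (auto simp: a_def b_def c_def d_def cmod_def complex_of_real_def power_mult_distrib real_sqrt_mult)
    have "L = contour_integral (rectpath a c) g"
      using total by (rule contour_integral_unique[symmetric])
    also have "\<dots> = contour_integral (linepath a b) g + (contour_integral (linepath b c) g
        + (contour_integral (linepath c d) g + contour_integral (linepath d a) g))"
      unfolding rp using segs by (simp add: integ)
    finally have "contour_integral (linepath a b) g - L = - (contour_integral (linepath b c) g
        + (contour_integral (linepath c d) g + contour_integral (linepath d a) g))"
      by simp
    then have "norm (contour_integral (linepath a b) g - L) \<le> norm (contour_integral (linepath b c) g)
        + (norm (contour_integral (linepath c d) g) + norm (contour_integral (linepath d a) g))"
      by (simp only: norm_minus_cancel) (rule order_trans[OF norm_triangle_ineq add_left_mono[OF norm_triangle_ineq]])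
    also have "\<dots> \<le> (2 * B / R / R) * R + ((2 * B / R / R) * (2 * R) + (2 * B / R / R) * R)"
      using far[OF segs(2) far_b] far[OF segs(3) far_c] far[OF segs(4) far_d] unfolding lens by linarith
    also have "\<dots> = 8 * B / R"
      using R by (simp add: field_simps)
    also have "contour_integral (linepath a b) g = integral {-R..R} (\<lambda>x. g (complex_of_real x))"
      using R by (subst contour_integral_linepath_Reals_eq) (auto simp: a_def b_def)
    finally show ?thesis .
  qed
  have lim_L: "(\<lambda>n. integral {- real n..real n} (\<lambda>x. g (complex_of_real x))) \<longlonglongrightarrow> L"
  proof (rule LIM_zero_cancel, rule Lim_null_comparison)
    have "\<forall>\<^sub>F n in sequentially. real n > 2 * norm q \<and> real n > 0"
      using filterlim_real_sequentially by (auto simp: filterlim_at_top_dense eventually_conj_iff)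
    then show "\<forall>\<^sub>F n in sequentially. norm (integral {- real n..real n} (\<lambda>x. g (complex_of_real x)) - L) \<le> 8 * B / real n"
      by eventually_elim (use rect in auto)
    show "(\<lambda>n. 8 * B / real n) \<longlonglongrightarrow> 0"
      by (rule lim_const_over_n)
  qed
  have lim_integral: "(\<lambda>n. integral {- real n..real n} (\<lambda>x. g (complex_of_real x))) \<longlonglongrightarrow> (\<integral>x. g (complex_of_real x) \<partial>lborel)"
  proof -
    have "integral {- real n..real n} (\<lambda>x. g (complex_of_real x))
        = (\<integral>x. indicator {- real n..real n} x *\<^sub>R g (complex_of_real x) \<partial>lborel)" for n
      using set_borel_integral_eq_integral(2)[OF borel_integrable_atLeastAtMost'[OF gcont_real]]
      by (simp add: set_lebesgue_integral_def)
    moreover have "(\<lambda>n. \<integral>x. indicator {- real n..real n} x *\<^sub>R g (complex_of_real x) \<partial>lborel)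
        \<longlonglongrightarrow> (\<integral>x. g (complex_of_real x) \<partial>lborel)"
    proof (rule integral_dominated_convergence[where w = "\<lambda>x. norm (g (complex_of_real x))"])
      show "AE x in lborel. (\<lambda>n. indicator {- real n..real n} x *\<^sub>R g (complex_of_real x)) \<longlonglongrightarrow> g (complex_of_real x)"
      proof (rule AE_I2, rule tendsto_eventually)
        fix x :: real
        obtain N :: nat where "\<bar>x\<bar> \<le> real N" using real_arch_simple by blast
        then show "\<forall>\<^sub>F n in sequentially. indicator {- real n..real n} x *\<^sub>R g (complex_of_real x) = g (complex_of_real x)"
          by (intro eventually_sequentiallyI[of N]) (auto simp: indicator_def)
      qed
    qed (use int in \<open>auto split: split_indicator\<close>)
    ultimately show ?thesis by simp
  qed
  show "(\<integral>x. h (complex_of_real x) / (complex_of_real x - q) \<partial>lborel)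
        = (if Im q > 0 then 2 * pi * \<i> * h q else 0)"
    using LIMSEQ_unique[OF lim_integral lim_L] unfolding L_def g_def .
qed


section \<open>Recognising reciprocal Cauchy transforms\<close>

text \<open>The hypotheses hold for the reciprocal Cauchy transform \<open>f\<close> of a compactly supported measure, and they pass
  from \<open>f\<close> to \<open>f \<circ> g - g + id\<close>, with the same constants, for any holomorphic \<open>g\<close> that raises imaginary parts.
  So orthogonal convolution can be iterated without following the supports of the iterates.\<close>

locale nevanlinna_map =
  fixes f :: "complex \<Rightarrow> complex" and C D :: real
  assumes hol: "f holomorphic_on upper_half_plane"
    and Im_ge: "\<And>z. Im z > 0 \<Longrightarrow> Im (f z) \<ge> Im z"
    and near_id: "\<And>z. Im z > 0 \<Longrightarrow> norm (f z - z) \<le> C + D / Im z"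
    and CD: "C \<ge> 0" "D \<ge> 0"
begin

lemma nonzero: "Im z > 0 \<Longrightarrow> f z \<noteq> 0"
  using Im_ge[of z] by auto

text \<open>The expected Cauchy transform \<open>1 / f\<close>, moved up by \<open>y\<close> so that it is holomorphic across the real line.\<close>

definition shifted :: "real \<Rightarrow> complex \<Rightarrow> complex" where
  "shifted y w = 1 / f (w + \<i> * y)"

lemma shifted_holomorphic: "shifted y holomorphic_on {w. Im w > - y}"
proof -
  have "f \<circ> (\<lambda>w. w + \<i> * y) holomorphic_on {w. Im w > - y}"
    by (rule holomorphic_on_compose_gen[OF _ hol])
       (auto simp: upper_half_plane_iff intro!: holomorphic_intros)
  then have "(\<lambda>w. f (w + \<i> * y)) holomorphic_on {w. Im w > - y}"
    by (simp only: o_def)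
  then show ?thesis
    unfolding shifted_def by (intro holomorphic_intros) (auto simp: nonzero)
qed

lemma shifted_decay:
  assumes y: "y > 0" and w: "Im w \<ge> 0"
  shows "norm (shifted y w) * (1 + norm w) \<le> 1 + (1 + (C + D / y) + y) / y"
proof -
  define v where "v = f (w + \<i> * y)"
  have v: "norm v \<ge> y" "norm v > 0"
    using Im_ge[of "w + \<i> * y"] abs_Im_le_cmod[of v] y w by (auto simp: v_def)
  have "D / (Im w + y) \<le> D / y"
    using y w CD by (intro divide_left_mono) auto
  then have "norm (v - (w + \<i> * y)) \<le> C + D / y"
    using near_id[of "w + \<i> * y"] y w by (simp add: v_def)
  moreover have "norm w \<le> norm v + norm (v - (w + \<i> * y)) + norm (\<i> * complex_of_real y)"
    using norm_triangle_ineq[of "v - (v - (w + \<i> * y))" "- \<i> * complex_of_real y"]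
      norm_triangle_ineq4[of v "v - (w + \<i> * y)"] by (simp add: norm_mult)
  ultimately have "norm w \<le> norm v + (C + D / y) + y"
    using y by (simp add: norm_mult)
  then have "1 + norm w \<le> norm v + (1 + (C + D / y) + y) * 1" by simp
  also have "\<dots> \<le> norm v + (1 + (C + D / y) + y) * (norm v / y)"
    using v y CD by (intro add_left_mono mult_left_mono) auto
  also have "\<dots> = norm v * (1 + (1 + (C + D / y) + y) / y)"
  proof -
    have "a + K * (a / y) = a * (1 + K / y)" for a K :: real by (simp add: distrib_left)
    then show ?thesis .
  qed
  finally have "1 + norm w \<le> norm v * (1 + (1 + (C + D / y) + y) / y)" .
  then show ?thesis
    using v(2) by (simp add: shifted_def v_def[symmetric] norm_divide pos_divide_le_eq mult.commute)
qed

text \<open>Stieltjes inversion: the density on the line at height \<open>y\<close> of the measure to be found.\<close>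

definition stieltjes_density :: "real \<Rightarrow> real \<Rightarrow> real" where
  "stieltjes_density y x = - Im (shifted y (complex_of_real x)) / pi"

lemma stieltjes_density_nonneg: "y > 0 \<Longrightarrow> stieltjes_density y x \<ge> 0"
  using Im_ge[of "complex_of_real x + \<i> * y"]
  by (simp add: stieltjes_density_def shifted_def Im_divide)

lemma stieltjes_density_continuous: "y > 0 \<Longrightarrow> continuous_on UNIV (stieltjes_density y)"
  unfolding stieltjes_density_def
  by (intro continuous_intros continuous_on_compose2[OF holomorphic_on_imp_continuous_on[OF shifted_holomorphic]])
     auto

lemma stieltjes_density_measurable [measurable]: "y > 0 \<Longrightarrow> stieltjes_density y \<in> borel_measurable borel"
  using stieltjes_density_continuous by (rule borel_measurable_continuous_onI)

text \<open>Subtract from the Cauchy integral with pole \<open>z\<close> the complex conjugate of the one with pole \<open>cnj z\<close>, which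
  vanishes. The numerator becomes \<open>h - cnj h = 2 \<i> Im h\<close>, while the denominator and the value at \<open>z\<close> stay the
  same.\<close>

lemma
  assumes y: "y > 0" and z: "Im z > 0"
  shows integrable_stieltjes_density:
      "integrable lborel (\<lambda>x. stieltjes_density y x *\<^sub>R (1 / (z - complex_of_real x)))"
    and cauchy_transform_stieltjes_density:
      "(\<integral>x. stieltjes_density y x *\<^sub>R (1 / (z - complex_of_real x)) \<partial>lborel) = shifted y z"
proof -
  have nz: "Im z \<noteq> 0" "Im (cnj z) \<noteq> 0" using z by auto
  note int = integrable_real_line[OF y shifted_holomorphic shifted_decay[OF y]]
  note val = cauchy_integral_real_line[OF y shifted_holomorphic shifted_decay[OF y]]
  define A where "A = (\<lambda>x. shifted y (complex_of_real x) / (complex_of_real x - z))"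
  define B where "B = (\<lambda>x. cnj (shifted y (complex_of_real x) / (complex_of_real x - cnj z)))"
  have eq: "stieltjes_density y x *\<^sub>R (1 / (z - complex_of_real x)) = (A x - B x) / (2 * pi * \<i>)" for x
  proof -
    have "shifted y (complex_of_real x) - cnj (shifted y (complex_of_real x))
        = 2 * \<i> * complex_of_real (Im (shifted y (complex_of_real x)))"
      by (simp add: complex_diff_cnj)
    then have "(A x - B x) / (2 * pi * \<i>) = complex_of_real (Im (shifted y (complex_of_real x))) / pi / (complex_of_real x - z)"
      by (simp add: A_def B_def diff_divide_distrib[symmetric])
    then show ?thesis
      using minus_divide_divide[of "complex_of_real (Im (shifted y (complex_of_real x))) / pi" "complex_of_real x - z"]
      by (simp add: stieltjes_density_def scaleR_conv_of_real)
  qed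
  have iA: "integrable lborel A"
    unfolding A_def by (rule int) (use z in auto)
  have iB: "integrable lborel B"
    unfolding B_def by (subst integrable_cnj, rule int) (use z in auto)
  show "integrable lborel (\<lambda>x. stieltjes_density y x *\<^sub>R (1 / (z - complex_of_real x)))"
    unfolding eq using iA iB by simp
  have "(\<integral>x. A x \<partial>lborel) = 2 * pi * \<i> * shifted y z"
    unfolding A_def using val[of z] z by simp
  moreover have "(\<integral>x. B x \<partial>lborel) = 0"
    unfolding B_def using val[of "cnj z"] z by (simp del: complex_cnj_divide)
  ultimately show "(\<integral>x. stieltjes_density y x *\<^sub>R (1 / (z - complex_of_real x)) \<partial>lborel) = shifted y z"
    unfolding eq using iA iB by simp
qed

text \<open>On the imaginary axis the real part of \<open>z / (z - x)\<close> is a nonnegative function of \<open>x\<close> that increases to \<open>1\<close> with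
  \<open>t\<close>. Its integral is known from the Cauchy transform, and this one family of test functions gives both the total
  mass, by monotone convergence, and a bound on the tails.\<close>

lemma Re_resolvent_imaginary:
  assumes "t > 0"
  shows "Re (\<i> * t * (1 / (\<i> * t - complex_of_real x))) = t\<^sup>2 / (t\<^sup>2 + x\<^sup>2)"
  by (simp add: Re_divide power2_eq_square add.commute)

lemma
  assumes y: "y > 0" and t: "t > 0"
  shows integrable_stieltjes_density_mass: "integrable lborel (\<lambda>x. stieltjes_density y x * (t\<^sup>2 / (t\<^sup>2 + x\<^sup>2)))"
    and stieltjes_density_mass: "(\<integral>x. stieltjes_density y x * (t\<^sup>2 / (t\<^sup>2 + x\<^sup>2)) \<partial>lborel) = Re (\<i> * t * shifted y (\<i> * t))"
proof -
  have z: "Im (\<i> * complex_of_real t) > 0" using t by simp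
  have eq: "stieltjes_density y x * (t\<^sup>2 / (t\<^sup>2 + x\<^sup>2))
    = Re (\<i> * t * (stieltjes_density y x *\<^sub>R (1 / (\<i> * t - complex_of_real x))))" for x
    unfolding mult_scaleR_right using Re_resolvent_imaginary[OF t, of x] by (simp del: Re_divide)
  have int: "integrable lborel (\<lambda>x. \<i> * t * (stieltjes_density y x *\<^sub>R (1 / (\<i> * t - complex_of_real x))))"
    by (intro integrable_mult_right integrable_stieltjes_density[OF y z])
  show "integrable lborel (\<lambda>x. stieltjes_density y x * (t\<^sup>2 / (t\<^sup>2 + x\<^sup>2)))"
    unfolding eq by (rule integrable_Re[OF int])
  show "(\<integral>x. stieltjes_density y x * (t\<^sup>2 / (t\<^sup>2 + x\<^sup>2)) \<partial>lborel) = Re (\<i> * t * shifted y (\<i> * t))"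
    unfolding eq integral_Re[OF int] integral_mult_right_zero cauchy_transform_stieltjes_density[OF y z] ..
qed

lemma shifted_near_infinity:
  assumes y: "y > 0" and t: "t > 0"
  shows "norm (1 - \<i> * t * shifted y (\<i> * t)) \<le> (C + D / t + y) / t"
proof -
  define w where "w = \<i> * complex_of_real t + \<i> * y"
  have w: "Im w = t + y" by (simp add: w_def)
  have fw: "norm (f w) \<ge> t"
    using Im_ge[of w] abs_Im_le_cmod[of "f w"] w y t by simp
  have "D / (t + y) \<le> D / t"
    using y t CD by (intro divide_left_mono) auto
  then have "norm (f w - w) \<le> C + D / t"
    using near_id[of w] w y t by simp
  moreover have split: "f w - \<i> * t = (f w - w) + \<i> * y"
    by (simp add: w_def)
  have "norm (f w - \<i> * t) \<le> norm (f w - w) + y"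
    unfolding split using norm_triangle_ineq[of "f w - w" "\<i> * complex_of_real y"] y by (simp add: norm_mult)
  ultimately have "norm (f w - \<i> * t) \<le> C + D / t + y"
    by linarith
  moreover have "1 - \<i> * t * shifted y (\<i> * t) = (f w - \<i> * t) / f w"
    using nonzero[of w] w y t by (simp add: shifted_def w_def[symmetric] diff_divide_distrib)
  ultimately show ?thesis
    using fw t y CD by (simp only: norm_divide) (intro frac_le; simp)
qed

lemma
  assumes y: "y > 0"
  shows integrable_density: "integrable lborel (stieltjes_density y)"
    and integral_density_eq_1: "(\<integral>x. stieltjes_density y x \<partial>lborel) = 1"
proof -
  define k where "k = (\<lambda>n x. stieltjes_density y x * ((real (Suc n))\<^sup>2 / ((real (Suc n))\<^sup>2 + x\<^sup>2)))"
  have int: "integrable lborel (k n)" for n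
    unfolding k_def by (rule integrable_stieltjes_density_mass[OF y]) simp
  have mono: "AE x in lborel. mono (\<lambda>n. k n x)"
  proof (intro AE_I2 monoI)
    fix x and m n :: nat assume "m \<le> n"
    have frac: "a / (a + x\<^sup>2) = 1 - x\<^sup>2 / (a + x\<^sup>2)" if "a > 0" for a :: real
      using add_pos_nonneg[OF that, of "x\<^sup>2"] by (simp add: field_simps)
    have "x\<^sup>2 / ((real (Suc n))\<^sup>2 + x\<^sup>2) \<le> x\<^sup>2 / ((real (Suc m))\<^sup>2 + x\<^sup>2)"
      using \<open>m \<le> n\<close> by (intro divide_left_mono add_right_mono power_mono) (auto intro!: mult_pos_pos add_pos_nonneg)
    then show "k m x \<le> k n x"
      unfolding k_def using stieltjes_density_nonneg[OF y] by (intro mult_left_mono) (simp_all add: frac)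
  qed
  have lim: "AE x in lborel. (\<lambda>n. k n x) \<longlonglongrightarrow> stieltjes_density y x"
  proof (rule AE_I2)
    fix x :: real
    have "(\<lambda>n. (real (Suc n))\<^sup>2 / ((real (Suc n))\<^sup>2 + x\<^sup>2)) \<longlonglongrightarrow> 1"
      by real_asymp
    then have "(\<lambda>n. k n x) \<longlonglongrightarrow> stieltjes_density y x * 1"
      unfolding k_def by (intro tendsto_mult tendsto_const)
    then show "(\<lambda>n. k n x) \<longlonglongrightarrow> stieltjes_density y x" by simp
  qed
  have lim_int: "(\<lambda>n. \<integral>x. k n x \<partial>lborel) \<longlonglongrightarrow> 1"
  proof (rule LIM_zero_cancel, rule Lim_null_comparison)
    show "\<forall>\<^sub>F n in sequentially. norm ((\<integral>x. k n x \<partial>lborel) - 1) \<le> (C + D / real (Suc n) + y) / real (Suc n)"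
    proof (rule always_eventually, rule allI)
      fix n
      have pos: "real (Suc n) > 0" by simp
      have "(\<integral>x. k n x \<partial>lborel) - 1 = - Re (1 - \<i> * real (Suc n) * shifted y (\<i> * real (Suc n)))"
        unfolding k_def stieltjes_density_mass[OF y pos] by simp
      then show "norm ((\<integral>x. k n x \<partial>lborel) - 1) \<le> (C + D / real (Suc n) + y) / real (Suc n)"
        using order_trans[OF abs_Re_le_cmod shifted_near_infinity[OF y pos]] by (simp only: real_norm_def abs_minus)
    qed
    show "(\<lambda>n. (C + D / real (Suc n) + y) / real (Suc n)) \<longlonglongrightarrow> 0"
      by real_asymp
  qed
  have [measurable]: "stieltjes_density y \<in> borel_measurable lborel"
    using stieltjes_density_measurable[OF y] by simp
  show "integrable lborel (stieltjes_density y)"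
    by (rule integrable_monotone_convergence[OF int mono lim lim_int]) measurable
  show "(\<integral>x. stieltjes_density y x \<partial>lborel) = 1"
    by (rule integral_monotone_convergence[OF int mono lim lim_int]) measurable
qed

definition stieltjes_measure :: "real \<Rightarrow> real measure" where
  "stieltjes_measure y = density lborel (stieltjes_density y)"

lemma real_distribution_stieltjes_measure:
  assumes y: "y > 0"
  shows "real_distribution (stieltjes_measure y)"
proof -
  have "(\<integral>\<^sup>+x. ennreal (stieltjes_density y x) \<partial>lborel) = 1"
    using nn_integral_eq_integral[OF integrable_density[OF y]] stieltjes_density_nonneg[OF y]
    by (simp add: integral_density_eq_1[OF y])
  then have "emeasure (stieltjes_measure y) (space (stieltjes_measure y)) = 1"
    unfolding stieltjes_measure_def using y by (simp add: emeasure_density)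
  then show ?thesis
    by (auto simp: real_distribution_def real_distribution_axioms_def stieltjes_measure_def intro: prob_spaceI)
qed

lemma cauchy_transform_stieltjes_measure:
  assumes y: "y > 0" and z: "Im z > 0"
  shows "cauchy_transform (stieltjes_measure y) z = shifted y z"
proof -
  have "cauchy_transform (stieltjes_measure y) z = (\<integral>x. stieltjes_density y x *\<^sub>R (1 / (z - complex_of_real x)) \<partial>lborel)"
    unfolding cauchy_transform_def stieltjes_measure_def
    by (rule integral_density) (use stieltjes_density_measurable[OF y] stieltjes_density_nonneg[OF y] in auto)
  then show ?thesis
    using cauchy_transform_stieltjes_density[OF y z] by simp
qed

text \<open>The bound is uniform in \<open>y \<le> 1\<close>, which makes the family tight as \<open>y\<close> tends to \<open>0\<close>.\<close>

lemma stieltjes_measure_tail: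
  assumes y: "y > 0" and t: "t > 0"
  shows "measure (stieltjes_measure y) {-t<..t} \<ge> 1 - 2 * (C + D / t + y) / t"
proof -
  interpret S: real_distribution "stieltjes_measure y"
    by (rule real_distribution_stieltjes_measure[OF y])
  define k where "k = (\<lambda>x. t\<^sup>2 / (t\<^sup>2 + x\<^sup>2))"
  have k: "0 \<le> k x" "k x \<le> 1" for x
    using t by (auto simp: k_def divide_le_eq_1 add_pos_nonneg)
  have intk: "integrable (stieltjes_measure y) k"
    by (rule S.integrable_bounded_borel[where B = 1]) (use k in \<open>auto simp: k_def\<close>)
  have "(\<integral>x. k x \<partial>stieltjes_measure y) = (\<integral>x. stieltjes_density y x *\<^sub>R k x \<partial>lborel)"
    unfolding stieltjes_measure_def
    by (rule integral_density) (use stieltjes_density_measurable[OF y] stieltjes_density_nonneg[OF y] in \<open>auto simp: k_def\<close>)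
  also have "\<dots> = Re (\<i> * t * shifted y (\<i> * t))"
    using stieltjes_density_mass[OF y t] by (simp add: k_def)
  also have "\<dots> \<ge> 1 - (C + D / t + y) / t"
    using shifted_near_infinity[OF y t] abs_Re_le_cmod[of "1 - \<i> * t * shifted y (\<i> * t)"] by simp
  finally have 1: "(\<integral>x. k x \<partial>stieltjes_measure y) \<ge> 1 - (C + D / t + y) / t" .
  \<comment> \<open>Outside \<open>(-t, t]\<close> the function \<open>k\<close> is at most \<open>1 / 2\<close>.\<close>
  have "(\<integral>x. k x \<partial>stieltjes_measure y) \<le> (\<integral>x. 1 / 2 + 1 / 2 * indicator {-t<..t} x \<partial>stieltjes_measure y)"
  proof (rule integral_mono[OF intk])
    show "integrable (stieltjes_measure y) (\<lambda>x. 1 / 2 + 1 / 2 * indicator {-t<..t} x :: real)"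
      by (rule S.integrable_bounded_borel[where B = 1]) (auto simp: indicator_def)
    fix x
    show "k x \<le> 1 / 2 + 1 / 2 * indicator {-t<..t} x"
    proof (cases "x \<in> {-t<..t}")
      case False
      then have "t \<le> \<bar>x\<bar>" by auto
      then have "t\<^sup>2 \<le> x\<^sup>2" using t abs_le_square_iff[of t x] by simp
      then show ?thesis using False t by (simp add: k_def pos_divide_le_eq add_pos_nonneg)
    qed (use k in simp)
  qed
  also have "\<dots> = 1 / 2 + 1 / 2 * measure (stieltjes_measure y) {-t<..t}"
  proof -
    have "integrable (stieltjes_measure y) (indicator {-t<..t} :: real \<Rightarrow> real)"
      by (rule S.integrable_bounded_borel[where B = 1]) (auto simp: indicator_def)
    then show ?thesis using S.prob_space by simp
  qed
  finally show ?thesis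
    unfolding times_divide_eq_right[symmetric] using 1 by linarith
qed

text \<open>Helly's selection theorem provides a weak limit of the measures with densities \<open>stieltjes_density y\<close>. The function
  \<open>x \<mapsto> 1 / (z - x)\<close> is bounded and continuous, so the Cauchy transforms converge as well.\<close>

theorem exists_distribution: "\<exists>\<rho>. real_distribution \<rho> \<and> (\<forall>z\<in>upper_half_plane. F_transform \<rho> z = f z)"
proof -
  define \<mu> where "\<mu> = (\<lambda>n. stieltjes_measure (1 / real (Suc n)))"
  have pos: "1 / real (Suc n) > 0" for n by simp
  have dist: "real_distribution (\<mu> n)" for n
    unfolding \<mu>_def by (rule real_distribution_stieltjes_measure[OF pos])
  have "tight \<mu>"
    unfolding tight_def
  proof (intro conjI allI impI dist)
    fix \<epsilon> :: real assume \<epsilon>: "\<epsilon> > 0"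
    define t where "t = max 1 (2 * (C + D + 1) / \<epsilon> + 1)"
    have t: "t \<ge> 1" "t > 2 * (C + D + 1) / \<epsilon>" by (auto simp: t_def)
    have "measure (\<mu> n) {-t<..t} > 1 - \<epsilon>" for n
    proof -
      have "D / t \<le> D" using t CD mult_left_mono[of 1 t D] by (simp add: pos_divide_le_eq)
      then have "2 * (C + D / t + 1 / real (Suc n)) / t \<le> 2 * (C + D + 1) / t"
        using t by (intro divide_right_mono mult_left_mono add_mono) auto
      also have "\<dots> < \<epsilon>"
        using t \<epsilon> by (simp add: pos_divide_less_eq mult.commute)
      finally show ?thesis
        using stieltjes_measure_tail[OF pos[of n], of t] t by (simp add: \<mu>_def)
    qed
    moreover have "-t < t" using t by simp
    ultimately show "\<exists>a b. a < b \<and> (\<forall>n. measure (\<mu> n) {a<..b} > 1 - \<epsilon>)" by blast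
  qed
  then obtain r \<rho> where r: "strict_mono (r :: nat \<Rightarrow> nat)" and \<rho>: "real_distribution \<rho>"
    and conv: "weak_conv_m (\<mu> \<circ> id \<circ> r) \<rho>"
    using tight_imp_convergent_subsubsequence[of \<mu> id] by (auto simp: strict_mono_id)
  interpret \<rho>: real_distribution \<rho> by fact
  have "F_transform \<rho> z = f z" if z: "z \<in> upper_half_plane" for z
  proof -
    have Imz: "Im z > 0" using z by (simp add: upper_half_plane_iff)
    have lim_\<rho>: "(\<lambda>n. cauchy_transform ((\<mu> \<circ> id \<circ> r) n) z) \<longlonglongrightarrow> cauchy_transform \<rho> z"
      unfolding cauchy_transform_def
    proof (rule weak_conv_imp_integral_bdd_continuous_conv[OF _ \<rho> conv])
      show "isCont (\<lambda>x. 1 / (z - complex_of_real x)) x" for x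
        using upper_half_plane_diff_neq_0[OF Imz] by (intro continuous_intros) auto
      show "norm (1 / (z - complex_of_real x)) \<le> 1 / Im z" for x
        by (rule norm_resolvent_le[OF Imz])
    qed (use dist in simp)
    have lim_f: "(\<lambda>n. cauchy_transform ((\<mu> \<circ> id \<circ> r) n) z) \<longlonglongrightarrow> 1 / f z"
    proof -
      have "(\<lambda>n. z + \<i> * complex_of_real (1 / real (Suc n))) \<longlonglongrightarrow> z + \<i> * complex_of_real 0"
        by (intro tendsto_intros LIMSEQ_Suc[OF lim_1_over_n])
      moreover have cont: "isCont f z"
        using holomorphic_on_imp_continuous_on[OF hol] z
        by (simp add: continuous_on_eq_continuous_at[OF open_upper_half_plane])
      ultimately have "(\<lambda>n. f (z + \<i> * complex_of_real (1 / real (Suc n)))) \<longlonglongrightarrow> f z"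
        using isCont_tendsto_compose[of z f] by simp
      then have "(\<lambda>n. 1 / f (z + \<i> * complex_of_real (1 / real (Suc n)))) \<longlonglongrightarrow> 1 / f z"
        using nonzero[OF Imz] by (intro tendsto_intros)
      then have "(\<lambda>n. cauchy_transform (\<mu> n) z) \<longlonglongrightarrow> 1 / f z"
        unfolding \<mu>_def cauchy_transform_stieltjes_measure[OF pos Imz] shifted_def .
      then show ?thesis
        using LIMSEQ_subseq_LIMSEQ[OF _ r] by (simp add: o_def)
    qed
    show ?thesis
      using LIMSEQ_unique[OF lim_\<rho> lim_f] by (simp add: F_transform_def)
  qed
  then show ?thesis using \<rho> by blast
qed

end


section \<open>Existence of the orthogonal convolution\<close>

context real_distribution
begin

text \<open>Far from the support, \<open>z G(z)\<close> is within \<open>1 / 2\<close> of \<open>1\<close> and even within \<open>O(R / \<bar>z\<bar>)\<close>, which bounds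
  \<open>F(z) - z = (1 - z G(z)) / G(z)\<close> by \<open>3 R\<close>. If \<open>\<bar>z\<bar> < 3 R\<close>, every point of the support is within \<open>4 R\<close> of \<open>z\<close>;
  then \<open>\<bar>Im G(z)\<bar>\<close> is at least \<open>Im z / (16 R\<^sup>2)\<close>, which bounds \<open>F(z)\<close> itself.\<close>

lemma norm_K_transform_le:
  assumes R: "R > 0" and supp: "AE x in M. \<bar>x\<bar> \<le> R" and z: "Im z > 0"
  shows "norm (F_transform M z - z) \<le> 3 * R + 16 * R\<^sup>2 / Im z"
proof -
  define G where "G = cauchy_transform M z"
  have G0: "G \<noteq> 0" using cauchy_transform_neq_0[OF z] by (simp add: G_def)
  have F: "F_transform M z - z = (1 - z * G) / G"
    using G0 by (simp add: F_transform_def G_def[symmetric] diff_divide_distrib)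
  show ?thesis
  proof (cases "norm z \<ge> 3 * R")
    case True
    then have nz: "norm z > 0" using R by linarith
    have int: "integrable M (\<lambda>x. z * (1 / (z - complex_of_real x)))"
      by (intro integrable_mult_right integrable_resolvent[OF z])
    have "z * (1 / (z - complex_of_real x)) - 1 = complex_of_real x / (z - complex_of_real x)" for x
      using upper_half_plane_diff_neq_0[OF z, of x] by (simp add: field_simps)
    then have "z * G - 1 = (\<integral>x. complex_of_real x / (z - complex_of_real x) \<partial>M)"
      using Bochner_Integration.integral_diff[OF int, of "\<lambda>_. 1"] prob_space
        integral_mult_right_zero[of M z "\<lambda>x. 1 / (z - complex_of_real x)"]
      by (simp add: G_def cauchy_transform_def)
    also have "norm \<dots> \<le> 3 * R / (2 * norm z)"
    proof -
      have "AE x in M. norm (complex_of_real x / (z - complex_of_real x)) \<le> 3 * R / (2 * norm z)"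
        using supp
      proof eventually_elim
        case (elim x)
        have "2 / 3 * norm z \<le> norm (z - complex_of_real x)"
          using norm_triangle_ineq2[of z "complex_of_real x"] elim True by simp
        then have "\<bar>x\<bar> / norm (z - complex_of_real x) \<le> R / (2 / 3 * norm z)"
          using elim nz R by (intro frac_le) auto
        then show ?case by (simp add: norm_divide)
      qed
      moreover from this have "integrable M (\<lambda>x. norm (complex_of_real x / (z - complex_of_real x)))"
        by (intro integrable_const_bound[of _ "3 * R / (2 * norm z)"]) auto
      ultimately show ?thesis
        by (intro order_trans[OF integral_norm_bound integral_le_const])
    qed
    finally have e: "norm (z * G - 1) \<le> 3 * R / (2 * norm z)" .
    have "3 * R / (2 * norm z) \<le> 1 / 2"
      using True nz by (simp add: pos_divide_le_eq)
    then have "1 / 2 \<le> norm (z * G)"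
      using e norm_triangle_ineq2[of 1 "1 - z * G"] by (simp add: norm_minus_commute)
    then have G: "norm G \<ge> 1 / (2 * norm z)"
      using nz by (simp add: norm_mult field_simps)
    have "norm (F_transform M z - z) \<le> (3 * R / (2 * norm z)) / (1 / (2 * norm z))"
      unfolding F norm_divide using e G nz R by (intro frac_le) (auto simp: norm_minus_commute)
    also have "\<dots> = 3 * R"
      using nz by simp
    finally have "norm (F_transform M z - z) \<le> 3 * R" .
    moreover have "0 \<le> 16 * R\<^sup>2 / Im z" using z by simp
    ultimately show ?thesis by linarith
  next
    case False
    have "(\<integral>x. 1 / (16 * R\<^sup>2) \<partial>M) \<le> (\<integral>x. (norm (1 / (z - complex_of_real x)))\<^sup>2 \<partial>M)"
    proof (rule integral_mono_AE)
      show "AE x in M. 1 / (16 * R\<^sup>2) \<le> (norm (1 / (z - complex_of_real x)))\<^sup>2"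
        using supp
      proof eventually_elim
        case (elim x)
        then have "norm (z - complex_of_real x) \<le> 4 * R"
          using norm_triangle_ineq4[of z "complex_of_real x"] False by simp
        moreover have "norm (z - complex_of_real x) > 0"
          using upper_half_plane_diff_neq_0[OF z] by simp
        ultimately have "(1 / (4 * R))\<^sup>2 \<le> (1 / norm (z - complex_of_real x))\<^sup>2"
          using R by (intro power_mono divide_left_mono) auto
        then show ?case by (simp add: norm_divide power_divide power_mult_distrib)
      qed
    qed (use integrable_norm_resolvent_sq[OF z] in auto)
    then have "1 / (16 * R\<^sup>2) \<le> (\<integral>x. (norm (1 / (z - complex_of_real x)))\<^sup>2 \<partial>M)"
      using prob_space by simp
    then have "Im z * (1 / (16 * R\<^sup>2)) \<le> Im z * (\<integral>x. (norm (1 / (z - complex_of_real x)))\<^sup>2 \<partial>M)"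
      using z by (intro mult_left_mono) auto
    also have "\<dots> \<le> norm G"
      using Im_cauchy_transform[OF z] abs_Im_le_cmod[of G] by (simp add: G_def)
    finally have "1 / norm G \<le> 1 / (Im z * (1 / (16 * R\<^sup>2)))"
      using z R G0 by (intro divide_left_mono) auto
    then have "norm (F_transform M z) \<le> 16 * R\<^sup>2 / Im z"
      by (simp add: F_transform_def G_def norm_divide)
    then show ?thesis
      using norm_triangle_ineq4[of "F_transform M z" z] False by simp
  qed
qed

text \<open>This expansion at infinity is the link to noncommutative distributions, which are given by moments.\<close>

lemma cauchy_transform_moments:
  assumes supp: "AE x in M. \<bar>x\<bar> \<le> R" and R: "R \<ge> 0" and z: "Im z > R"
  shows "(\<lambda>n. complex_of_real (\<integral>x. x ^ n \<partial>M) / z ^ Suc n) sums cauchy_transform M z"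
proof -
  have Rz: "R < norm z" and Imz: "Im z > 0" using z R abs_Im_le_cmod[of z] by auto
  define f where "f = (\<lambda>n x. complex_of_real (x ^ n) / z ^ Suc n)"
  have z0: "norm z > 0" using Rz R by linarith
  have bound: "AE x in M. norm (f n x) \<le> (R / norm z) ^ n * (1 / norm z)" for n
    using supp
  proof eventually_elim
    case (elim x)
    then have "\<bar>x\<bar> ^ n \<le> R ^ n" by (intro power_mono) auto
    then have "\<bar>x\<bar> ^ n / norm z ^ Suc n \<le> R ^ n / norm z ^ Suc n"
      by (intro divide_right_mono) auto
    then show ?case
      by (simp add: f_def norm_divide norm_power norm_mult power_abs power_divide mult.commute)
  qed
  have int: "integrable M (f n)" for n
    by (rule integrable_const_bound[OF bound]) (simp add: f_def)
  have geom: "(\<lambda>n. f n x) sums (1 / (z - complex_of_real x))" and geom_norm: "summable (\<lambda>n. norm (f n x))" if "\<bar>x\<bar> \<le> R" for x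
  proof -
    have lt: "norm (complex_of_real x / z) < 1"
      using that Rz z0 by (simp add: norm_divide)
    have eq: "f n x = (complex_of_real x / z) ^ n * (1 / z)" for n
      by (simp add: f_def power_divide mult.commute)
    have "(1 / (1 - complex_of_real x / z)) * (1 / z) = 1 / (z - complex_of_real x)"
      using z0 upper_half_plane_diff_neq_0[OF Imz, of x] by (simp add: field_simps)
    then show "(\<lambda>n. f n x) sums (1 / (z - complex_of_real x))"
      unfolding eq using sums_mult2[OF geometric_sums[OF lt], of "1 / z"] by simp
    show "summable (\<lambda>n. norm (f n x))"
      unfolding eq norm_mult norm_power
      using summable_mult2[OF summable_geometric, of "norm (complex_of_real x / z)"] lt by simp
  qed
  have "(\<lambda>n. \<integral>x. f n x \<partial>M) sums (\<integral>x. (\<Sum>n. f n x) \<partial>M)"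
  proof (rule sums_integral[OF int])
    show "AE x in M. summable (\<lambda>n. norm (f n x))"
      using supp by eventually_elim (rule geom_norm)
    show "summable (\<lambda>n. \<integral>x. norm (f n x) \<partial>M)"
    proof (rule summable_comparison_test')
      show "summable (\<lambda>n. (R / norm z) ^ n * (1 / norm z))"
        using R Rz z0 by (intro summable_mult2 summable_geometric) simp
      show "norm (\<integral>x. norm (f n x) \<partial>M) \<le> (R / norm z) ^ n * (1 / norm z)" for n
        using integral_le_const[OF integrable_norm[OF int] bound, of n] by simp
    qed
  qed
  moreover have "(\<integral>x. (\<Sum>n. f n x) \<partial>M) = cauchy_transform M z"
    unfolding cauchy_transform_def
  proof (rule integral_cong_AE)
    show "AE x in M. (\<Sum>n. f n x) = 1 / (z - complex_of_real x)"
      using supp by eventually_elim (use geom sums_unique in force)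
  qed (auto simp: f_def)
  moreover have "(\<integral>x. f n x \<partial>M) = complex_of_real (\<integral>x. x ^ n \<partial>M) / z ^ Suc n" for n
    unfolding f_def by (simp only: integral_divide_zero integral_complex_of_real)
  ultimately show ?thesis by simp
qed

end

lemma compactly_supported_bound:
  assumes "compactly_supported M"
  obtains R where "R > 0" "AE x in M. \<bar>x\<bar> \<le> R"
proof -
  obtain C where C: "compact C" "AE x in M. x \<in> C"
    using assms by (auto simp: compactly_supported_def)
  obtain R where "R > 0" "\<And>x. x \<in> C \<Longrightarrow> \<bar>x\<bar> \<le> R"
    using compact_imp_bounded[OF C(1)] by (auto simp: bounded_pos)
  then show thesis using C(2) by (intro that[of R]) auto
qed

lemma nevanlinna_map_F_transform:
  assumes M: "real_distribution M" and supp: "compactly_supported M"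
  obtains C D where "nevanlinna_map (F_transform M) C D"
proof -
  interpret real_distribution M by fact
  obtain R where R: "R > 0" "AE x in M. \<bar>x\<bar> \<le> R"
    using compactly_supported_bound[OF supp] .
  have "nevanlinna_map (F_transform M) (3 * R) (16 * R\<^sup>2)"
    by unfold_locales (use holomorphic_F_transform Im_F_transform_ge norm_K_transform_le[OF R] R in auto)
  then show thesis by (rule that)
qed

text \<open>Existence and uniqueness together unfold the definite description of \<open>orth_conv\<close>. The transform of the second factor
  enters only as a holomorphic map that raises imaginary parts, so every probability measure can take this place.\<close>

theorem
  assumes "real_distribution M" "compactly_supported M" "real_distribution N"
  shows real_distribution_orth_conv: "real_distribution (orth_conv M N)"
    and F_transform_orth_conv: "\<And>z. z \<in> upper_half_plane \<Longrightarrow>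
      F_transform (orth_conv M N) z = F_transform M (F_transform N z) - F_transform N z + z"
proof -
  interpret M: real_distribution M by fact
  interpret N: real_distribution N by fact
  obtain C D where "nevanlinna_map (F_transform M) C D"
    using nevanlinna_map_F_transform[OF assms(1,2)] .
  then interpret nevanlinna_map "F_transform M" C D .
  define f where "f = (\<lambda>z. F_transform M (F_transform N z) - F_transform N z + z)"
  have "nevanlinna_map f C D"
  proof
    have "F_transform M \<circ> F_transform N holomorphic_on upper_half_plane"
      by (rule holomorphic_on_compose_gen[OF N.holomorphic_F_transform M.holomorphic_F_transform])
         (use N.F_transform_in_upper_half_plane in auto)
    then show "f holomorphic_on upper_half_plane"
      unfolding f_def by (intro holomorphic_intros N.holomorphic_F_transform) (simp add: o_def)
    fix z assume z: "Im z > 0"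
    have w: "Im (F_transform N z) \<ge> Im z" by (rule N.Im_F_transform_ge[OF z])
    then have w0: "Im (F_transform N z) > 0" using z by simp
    show "Im (f z) \<ge> Im z"
      using M.Im_F_transform_ge[OF w0] by (simp add: f_def)
    have "D / Im (F_transform N z) \<le> D / Im z"
      using w z CD by (intro divide_left_mono) auto
    then show "norm (f z - z) \<le> C + D / Im z"
      using near_id[OF w0] by (simp add: f_def)
  qed (use CD in auto)
  from nevanlinna_map.exists_distribution[OF this]
  have "\<exists>!\<rho>. real_distribution \<rho> \<and> (\<forall>z\<in>upper_half_plane.
        F_transform \<rho> z = F_transform M (F_transform N z) - F_transform N z + z)"
    unfolding f_def
  proof (rule ex_ex1I, elim conjE)
    fix a b assume "real_distribution a" "real_distribution b"
      "\<forall>z\<in>upper_half_plane. F_transform a z = F_transform M (F_transform N z) - F_transform N z + z"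
      "\<forall>z\<in>upper_half_plane. F_transform b z = F_transform M (F_transform N z) - F_transform N z + z"
    then show "a = b" by (intro F_transform_unique) simp_all
  qed
  from theI'[OF this] show "real_distribution (orth_conv M N)"
    and "\<And>z. z \<in> upper_half_plane \<Longrightarrow>
      F_transform (orth_conv M N) z = F_transform M (F_transform N z) - F_transform N z + z"
    unfolding orth_conv_def by auto
qed

lemma real_distribution_orth_conv_iter:
  assumes "real_distribution M" "compactly_supported M" "real_distribution N" "compactly_supported N"
  shows "real_distribution (orth_conv_iter n M N)"
  using assms
proof (induction n arbitrary: M N)
  case (Suc n)
  then show ?case
    unfolding orth_conv_iter.simps by (intro real_distribution_orth_conv Suc.IH)
qed simp

lemma F_transform_orth_conv_iter_Suc:
  assumes "real_distribution M" "compactly_supported M" "real_distribution N" "compactly_supported N"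
    and "z \<in> upper_half_plane"
  shows "F_transform (orth_conv_iter (Suc n) M N) z = z - K_transform M (F_transform (orth_conv_iter n N M) z)"
  using F_transform_orth_conv[OF assms(1,2) real_distribution_orth_conv_iter[OF assms(3,4,1,2)] assms(5)]
  unfolding orth_conv_iter.simps K_transform_def by simp

text \<open>The bound does not depend on \<open>n\<close>: the transform differs from \<open>z\<close> by the value of \<open>K\<close> at a point that is at least as
  high as \<open>z\<close>, whatever the earlier steps were.\<close>

lemma F_transform_orth_conv_iter_near_id:
  assumes M: "real_distribution M" "compactly_supported M" and N: "real_distribution N" "compactly_supported N"
    and F: "nevanlinna_map (F_transform M) C D" and z: "Im z > 0"
  shows "norm (F_transform (orth_conv_iter n M N) z - z) \<le> C + D / Im z"
proof (cases n)
  case 0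
  then show ?thesis using nevanlinna_map.near_id[OF F z] by simp
next
  case (Suc m)
  interpret nevanlinna_map "F_transform M" C D by fact
  interpret I: real_distribution "orth_conv_iter m N M"
    by (rule real_distribution_orth_conv_iter[OF N M])
  define w where "w = F_transform (orth_conv_iter m N M) z"
  have w: "Im w \<ge> Im z" unfolding w_def by (rule I.Im_F_transform_ge[OF z])
  have "F_transform (orth_conv_iter n M N) z - z = F_transform M w - w"
    using F_transform_orth_conv_iter_Suc[OF M N, of z m] z
    by (simp add: Suc w_def K_transform_def upper_half_plane_iff del: orth_conv_iter.simps)
  moreover have "norm (F_transform M w - w) \<le> C + D / Im w"
    by (rule near_id) (use w z in simp)
  moreover have "D / Im w \<le> D / Im z"
    using w z CD by (intro divide_left_mono) auto
  ultimately show ?thesis by simp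
qed


section \<open>Vitali convergence and contraction near infinity\<close>

text \<open>Otherwise some subsequence stays away from \<open>h\<close> on the compact set. By Montel's theorem a further subsequence converges
  locally uniformly, and by the identity theorem its limit is \<open>h\<close>, since it is so on \<open>U\<close>.\<close>

lemma vitali_convergence:
  fixes F :: "nat \<Rightarrow> complex \<Rightarrow> complex"
  assumes S: "open S" "connected S" and hol: "\<And>n. F n holomorphic_on S"
    and bounded: "\<And>K. compact K \<Longrightarrow> K \<subseteq> S \<Longrightarrow> \<exists>B. \<forall>n. \<forall>z\<in>K. norm (F n z) \<le> B"
    and h: "h holomorphic_on S"
    and U: "open U" "U \<subseteq> S" "U \<noteq> {}" and lim: "\<And>z. z \<in> U \<Longrightarrow> (\<lambda>n. F n z) \<longlonglongrightarrow> h z"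
    and C: "compact C" "C \<subseteq> S"
  shows "uniform_limit C F h sequentially"
proof (rule ccontr)
  assume "\<not> uniform_limit C F h sequentially"
  then obtain e where e: "e > 0" and "\<not> (\<forall>\<^sub>F n in sequentially. \<forall>z\<in>C. dist (F n z) (h z) < e)"
    by (auto simp: uniform_limit_iff)
  then obtain s where s: "strict_mono (s :: nat \<Rightarrow> nat)"
    and far: "\<And>n. \<not> (\<forall>z\<in>C. dist (F (s n) z) (h z) < e)"
    using not_eventually_sequentiallyD by blast
  obtain g r where g: "g holomorphic_on S" and r: "strict_mono (r :: nat \<Rightarrow> nat)"
    and ptw: "\<And>z. z \<in> S \<Longrightarrow> (\<lambda>n. (F \<circ> s) (r n) z) \<longlonglongrightarrow> g z"
    and unif: "\<And>K. compact K \<Longrightarrow> K \<subseteq> S \<Longrightarrow> uniform_limit K ((F \<circ> s) \<circ> r) g sequentially"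
  proof (rule Montel[of S "range F" "F \<circ> s"])
    show "\<exists>B. \<forall>h\<in>range F. \<forall>z\<in>K. norm (h z) \<le> B" if "compact K" "K \<subseteq> S" for K
      using bounded[OF that] by auto
  qed (use S hol in auto)
  have "g z = h z" if "z \<in> U" for z
  proof (rule LIMSEQ_unique)
    show "(\<lambda>n. (F \<circ> s) (r n) z) \<longlonglongrightarrow> g z" using ptw that U by blast
    show "(\<lambda>n. (F \<circ> s) (r n) z) \<longlonglongrightarrow> h z"
      using LIMSEQ_subseq_LIMSEQ[OF lim[OF that] strict_mono_o[OF s r]] by (simp add: o_def)
  qed
  then have eq: "g z = h z" if "z \<in> S" for z
    using analytic_continuation_open[OF U(1) S(1) U(3) S(2) U(2) g h] that by blast
  have "\<forall>\<^sub>F n in sequentially. \<forall>z\<in>C. dist (((F \<circ> s) \<circ> r) n z) (g z) < e"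
    using unif[OF C] e by (auto simp: uniform_limit_iff)
  then obtain n where "\<forall>z\<in>C. dist (F (s (r n)) z) (g z) < e"
    by (auto simp: eventually_sequentially)
  moreover have "g z = h z" if "z \<in> C" for z
    using eq C(2) that by blast
  ultimately show False
    using far[of "r n"] by simp
qed

lemma vitali_upper_half_plane:
  fixes H :: "nat \<Rightarrow> complex \<Rightarrow> complex"
  assumes hol: "\<And>n. H n holomorphic_on upper_half_plane"
    and bound: "\<And>n z. Im z > 0 \<Longrightarrow> norm (H n z) \<le> norm z + C + D / Im z"
    and h: "h holomorphic_on upper_half_plane"
    and lim: "\<And>z. Im z > Y \<Longrightarrow> (\<lambda>n. H n z) \<longlonglongrightarrow> h z" and Y: "Y > 0"
    and K: "compact K" "K \<subseteq> upper_half_plane"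
  shows "uniform_limit K H h sequentially"
proof (rule vitali_convergence[OF open_upper_half_plane _ hol _ h _ _ _ _ K])
  show "connected upper_half_plane"
    by (rule convex_connected[OF convex_upper_half_plane])
  show "open {z. Im z > Y}" by (rule open_halfspace_Im_gt)
  show "{z. Im z > Y} \<subseteq> upper_half_plane" using Y by (auto simp: upper_half_plane_iff)
  show "{z. Im z > Y} \<noteq> {}" by (auto intro: exI[of _ "\<i> * complex_of_real (Y + 1)"])
  show "(\<lambda>n. H n z) \<longlonglongrightarrow> h z" if "z \<in> {z. Im z > Y}" for z using lim that by simp
  show "\<exists>B. \<forall>n. \<forall>z\<in>L. norm (H n z) \<le> B" if L: "compact L" "L \<subseteq> upper_half_plane" for L
  proof -
    have "continuous_on L (\<lambda>z. norm z + C + D / Im z)"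
      using L by (intro continuous_intros) (auto simp: upper_half_plane_iff)
    then have "bounded ((\<lambda>z. norm z + C + D / Im z) ` L)"
      using L by (intro compact_imp_bounded compact_continuous_image)
    then obtain B where B: "\<And>z. z \<in> L \<Longrightarrow> norm (norm z + C + D / Im z) \<le> B"
      by (auto simp: bounded_iff)
    have "norm (H n z) \<le> B" if "z \<in> L" for n z
    proof -
      have "Im z > 0" using that L(2) upper_half_plane_iff by blast
      from bound[OF this, of n] show ?thesis using B[OF that] by simp
    qed
    then show ?thesis by blast
  qed
qed

text \<open>The map \<open>w \<mapsto> w - f w\<close> is bounded by \<open>C + D\<close> above height \<open>1\<close>. By Cauchy's inequality its derivative at height
  \<open>r + 1\<close> is at most \<open>(C + D) / r\<close>, which is small for large \<open>r\<close>.\<close>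

lemma (in nevanlinna_map) lipschitz_near_infinity:
  obtains Y where "Y > 0" "\<And>u v. Im u \<ge> Y \<Longrightarrow> Im v \<ge> Y \<Longrightarrow> norm ((u - f u) - (v - f v)) \<le> 1 / 2 * norm (u - v)"
proof -
  define r where "r = 2 * (C + D) + 1"
  define k where "k = (\<lambda>w. w - f w)"
  have r: "r > 0" using CD by (simp add: r_def)
  have k_hol: "k holomorphic_on upper_half_plane"
    unfolding k_def by (intro holomorphic_intros hol)
  have k_bound: "norm (k w) \<le> C + D" if "Im w \<ge> 1" for w
  proof -
    have "D / Im w \<le> D" using that CD mult_left_mono[of 1 "Im w" D] by (simp add: pos_divide_le_eq)
    then show ?thesis
      using near_id[of w] that by (simp add: k_def norm_minus_commute)
  qed
  have cball: "Im w \<ge> 1" if "Im u \<ge> r + 1" "w \<in> cball u r" for u w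
    using that abs_Im_le_cmod[of "u - w"] by (simp add: dist_norm)
  have deriv: "norm (deriv k u) \<le> 1 / 2" if u: "Im u \<ge> r + 1" for u
  proof -
    have sub: "cball u r \<subseteq> upper_half_plane"
      using cball[OF u] by (force simp: upper_half_plane_iff)
    have "norm ((deriv ^^ 1) k u) \<le> fact 1 * (C + D) / r ^ 1"
    proof (rule Cauchy_inequality)
      show "k holomorphic_on ball u r"
        using k_hol sub by (meson ball_subset_cball holomorphic_on_subset)
      show "continuous_on (cball u r) k"
        using k_hol sub by (meson holomorphic_on_imp_continuous_on holomorphic_on_subset)
      show "norm (k w) \<le> C + D" if "norm (u - w) = r" for w
        using that by (intro k_bound cball[OF u]) (simp add: dist_norm)
    qed (rule r)
    also have "fact 1 * (C + D) / r ^ 1 \<le> 1 / 2"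
      using r by (simp add: r_def pos_divide_le_eq)
    finally show ?thesis by simp
  qed
  have "norm (k u - k v) \<le> 1 / 2 * norm (u - v)" if "Im u \<ge> r + 1" "Im v \<ge> r + 1" for u v
  proof (rule field_differentiable_bound[of "{w. Im w \<ge> r + 1}" k "deriv k"])
    show "convex {w. Im w \<ge> r + 1}" by (rule convex_halfspace_Im_ge)
    show "(k has_field_derivative deriv k w) (at w within {w. Im w \<ge> r + 1})" if "w \<in> {w. Im w \<ge> r + 1}" for w
      using that r holomorphic_derivI[OF k_hol open_upper_half_plane, of w]
      by (auto simp: upper_half_plane_iff intro: has_field_derivative_at_within)
  qed (use that deriv in auto)
  then show thesis
    using that[of "r + 1"] r by (simp add: k_def)
qed

text \<open>The pair \<open>(u n, v n)\<close> is the orbit of the contraction \<open>(a, b) \<mapsto> (p b, q a)\<close> of the complete space \<open>S \<times> S\<close>.\<close>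

lemma alternating_iteration_converges:
  fixes u v :: "nat \<Rightarrow> complex"
  assumes S: "closed S" and u0: "u 0 \<in> S" and v0: "v 0 \<in> S"
    and u: "\<And>n. u (Suc n) = p (v n)" and v: "\<And>n. v (Suc n) = q (u n)"
    and maps: "\<And>w. w \<in> S \<Longrightarrow> p w \<in> S" "\<And>w. w \<in> S \<Longrightarrow> q w \<in> S"
    and lip: "\<And>a b. a \<in> S \<Longrightarrow> b \<in> S \<Longrightarrow> dist (p a) (p b) \<le> 1 / 2 * dist a b"
      "\<And>a b. a \<in> S \<Longrightarrow> b \<in> S \<Longrightarrow> dist (q a) (q b) \<le> 1 / 2 * dist a b"
  obtains a b where "a \<in> S" "b \<in> S" "a = p b" "b = q a" "u \<longlonglongrightarrow> a" "v \<longlonglongrightarrow> b"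
proof -
  define T where "T = (\<lambda>(a, b). (p b, q a))"
  have "\<exists>!x\<in>S \<times> S. T x = x"
  proof (rule Banach_fix[OF complete_eq_closed[THEN iffD2, OF closed_Times[OF S S]], where c = "1 / 2"])
    show "T ` (S \<times> S) \<subseteq> S \<times> S" using maps by (auto simp: T_def)
    fix x y assume x: "x \<in> S \<times> S" and y: "y \<in> S \<times> S"
    obtain a b c d where [simp]: "x = (a, b)" "y = (c, d)" by (cases x, cases y)
    have "(dist (p b) (p d))\<^sup>2 \<le> (1 / 2 * dist b d)\<^sup>2" "(dist (q a) (q c))\<^sup>2 \<le> (1 / 2 * dist a c)\<^sup>2"
      using x y lip by (auto intro!: power_mono)
    then have "(dist (p b) (p d))\<^sup>2 + (dist (q a) (q c))\<^sup>2 \<le> (1 / 2)\<^sup>2 * ((dist a c)\<^sup>2 + (dist b d)\<^sup>2)"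
      by (simp add: power_mult_distrib power_divide)
    then have "dist (T x) (T y) \<le> sqrt ((1 / 2)\<^sup>2 * ((dist a c)\<^sup>2 + (dist b d)\<^sup>2))"
      by (simp add: T_def dist_Pair_Pair del: real_sqrt_mult)
    then show "dist (T x) (T y) \<le> 1 / 2 * dist x y"
      by (simp add: dist_Pair_Pair real_sqrt_mult del: power_divide)
  qed (use u0 in auto)
  then obtain a b where ab: "a \<in> S" "b \<in> S" "p b = a" "q a = b"
    by (auto simp: T_def)
  define c where "c = max (dist (u 0) a) (dist (v 0) b)"
  have step: "u n \<in> S \<and> v n \<in> S \<and> dist (u n) a \<le> c * (1 / 2) ^ n \<and> dist (v n) b \<le> c * (1 / 2) ^ n" for n
  proof (induction n)
    case 0
    show ?case using u0 v0 by (simp add: c_def)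
  next
    case (Suc n)
    have "dist (u (Suc n)) a \<le> 1 / 2 * dist (v n) b" "dist (v (Suc n)) b \<le> 1 / 2 * dist (u n) a"
      using lip(1)[of "v n" b] lip(2)[of "u n" a] Suc ab unfolding u v by auto
    moreover have "u (Suc n) \<in> S" "v (Suc n) \<in> S"
      using Suc maps by (auto simp: u v)
    ultimately show ?case
      using Suc by auto
  qed
  have null: "(\<lambda>n. c * (1 / 2) ^ n) \<longlonglongrightarrow> 0"
    by (intro tendsto_mult_right_zero LIMSEQ_power_zero) simp
  have "u \<longlonglongrightarrow> a"
    by (rule tendsto_dist_iff[THEN iffD2], rule Lim_null_comparison[OF _ null]) (use step in simp)
  moreover have "v \<longlonglongrightarrow> b"
    by (rule tendsto_dist_iff[THEN iffD2], rule Lim_null_comparison[OF _ null]) (use step in simp)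
  ultimately show thesis
    using that[OF ab(1,2) ab(3)[symmetric] ab(4)[symmetric]] by simp
qed


section \<open>Freeness and the resolvent of a sum\<close>

lemma
  fixes x :: "'a::{real_normed_algebra_1, banach}"
  assumes "norm x < 1"
  shows neumann_sums: "(\<lambda>n. x ^ n) sums (\<Sum>n. x ^ n)"
    and neumann_right: "(1 - x) * (\<Sum>n. x ^ n) = 1"
    and neumann_left: "(\<Sum>n. x ^ n) * (1 - x) = 1"
    and norm_neumann_minus_1: "norm ((\<Sum>n. x ^ n) - 1) \<le> norm x / (1 - norm x)"
proof -
  define N where "N = (\<Sum>n. x ^ n)"
  show sums: "(\<lambda>n. x ^ n) sums (\<Sum>n. x ^ n)"
    by (rule summable_sums[OF complete_algebra_summable_geometric[OF assms]])
  then have tail: "(\<lambda>n. x ^ Suc n) sums (N - 1)"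
    using sums_Suc_iff[of "\<lambda>n. x ^ n" "N - 1"] by (simp add: N_def)
  have shifted: "(\<lambda>n. x ^ Suc n) sums (x * N)" "(\<lambda>n. x ^ Suc n) sums (N * x)"
    using sums_mult[OF sums, of x] sums_mult2[OF sums, of x] by (simp_all add: N_def power_commutes)
  have eq: "x * N = N - 1" "N * x = N - 1"
    by (rule sums_unique2[OF shifted(1) tail] sums_unique2[OF shifted(2) tail])+
  then show "(1 - x) * (\<Sum>n. x ^ n) = 1" "(\<Sum>n. x ^ n) * (1 - x) = 1"
    unfolding N_def[symmetric] by (simp_all add: algebra_simps)
  have "norm (N - 1) \<le> norm x * norm N"
    unfolding eq(1)[symmetric] by (rule norm_mult_ineq)
  also have "\<dots> \<le> norm x * (norm (N - 1) + 1)"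
    using norm_triangle_ineq[of "N - 1" 1] by (intro mult_left_mono) auto
  finally have "norm (N - 1) * (1 - norm x) \<le> norm x"
    by (simp add: algebra_simps)
  then show "norm ((\<Sum>n. x ^ n) - 1) \<le> norm x / (1 - norm x)"
    using assms by (simp add: N_def pos_le_divide_eq)
qed

context cstar_probability_space
begin

text \<open>The C*-identity determines the norm of a complex multiple, because \<open>c\<close> enters \<open>star a * a\<close> only through the
  real number \<open>\<bar>c\<bar>\<^sup>2\<close>.\<close>

lemma norm_scaleC: "norm (scaleC c a) = norm c * norm a"
proof -
  have "star (scaleC c a) * scaleC c a = scaleC (cnj c * c) (star a * a)"
    by (simp add: star_scaleC scaleC_mult_left scaleC_mult_right)
  also have "cnj c * c = complex_of_real ((norm c)\<^sup>2)"
    by (metis complex_norm_square mult.commute of_real_power)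
  finally have "(norm (scaleC c a))\<^sup>2 = (norm c * norm a)\<^sup>2"
    using cstar_identity[of "scaleC c a"] cstar_identity[of a]
    by (simp only: scaleC_of_real norm_scaleR power_mult_distrib) simp
  then show ?thesis
    by (simp add: power2_eq_iff_nonneg)
qed

lemma scaleC_scaleR: "scaleC c (r *\<^sub>R a) = r *\<^sub>R scaleC c a"
  by (simp add: scaleC_of_real[symmetric] mult.commute)

lemma bounded_linear_scaleC: "bounded_linear (scaleC c)"
  by (rule bounded_linear_intro[where K = "norm c"])
     (simp_all add: scale_right_distrib scaleC_scaleR norm_scaleC mult.commute)

lemma bounded_linear_state: "bounded_linear \<phi>"
proof (rule bounded_linear_intro[where K = 1])
  show "\<phi> (r *\<^sub>R a) = r *\<^sub>R \<phi> a" for r a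
    by (simp add: scaleC_of_real[symmetric] state_scaleC scaleR_conv_of_real)
qed (simp_all add: state_add state_norm)

lemma state_diff: "\<phi> (a - b) = \<phi> a - \<phi> b"
  by (rule bounded_linear.linear[OF bounded_linear_state, THEN linear_diff])

lemma scaleC_power: "scaleC c a ^ n = scaleC (c ^ n) (a ^ n)"
  by (induction n) (simp_all add: scaleC_mult_left scaleC_mult_right)

text \<open>The Neumann series of the inverse of \<open>w - X\<close>, which is meaningful for \<open>norm X < norm w\<close>.\<close>

definition resolvent :: "complex \<Rightarrow> 'a \<Rightarrow> 'a" where
  "resolvent w X = scaleC (1 / w) (\<Sum>n. scaleC (1 / w) X ^ n)"

context
  fixes w :: complex and X :: 'a
  assumes large: "norm X < norm w"
begin

lemma norm_quotient_lt_1: "norm (scaleC (1 / w) X) < 1"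
  using large le_less_trans[OF norm_ge_zero large] by (simp add: norm_scaleC norm_divide)

lemma w_nonzero: "w \<noteq> 0"
  using large by auto

lemma scaleC_one_diff_eq: "scaleC w 1 - X = scaleC w (1 - scaleC (1 / w) X)"
  by (simp add: scale_right_diff_distrib w_nonzero)

lemma resolvent_right: "(scaleC w 1 - X) * resolvent w X = 1"
  unfolding scaleC_one_diff_eq resolvent_def scaleC_mult_left scaleC_mult_right
    neumann_right[OF norm_quotient_lt_1]
  by (simp add: w_nonzero)

lemma resolvent_left: "resolvent w X * (scaleC w 1 - X) = 1"
  unfolding scaleC_one_diff_eq resolvent_def scaleC_mult_left scaleC_mult_right
    neumann_left[OF norm_quotient_lt_1]
  by (simp add: w_nonzero)

lemma resolvent_sums: "(\<lambda>n. scaleC (1 / w ^ Suc n) (X ^ n)) sums resolvent w X"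
proof -
  have "(\<lambda>n. scaleC (1 / w) (scaleC (1 / w) X ^ n)) sums resolvent w X"
    unfolding resolvent_def
    by (rule bounded_linear.sums[OF bounded_linear_scaleC neumann_sums[OF norm_quotient_lt_1]])
  then show ?thesis by (simp add: scaleC_power power_divide)
qed

lemma state_resolvent_sums: "(\<lambda>n. \<phi> (X ^ n) / w ^ Suc n) sums \<phi> (resolvent w X)"
  using bounded_linear.sums[OF bounded_linear_state resolvent_sums] by (simp add: state_scaleC)

lemma resolvent_in_closure: "resolvent w X \<in> closure (generated_algebra scaleC X)"
proof -
  have "(\<Sum>n<m. scaleC (1 / w ^ Suc n) (X ^ n)) \<in> generated_algebra scaleC X" for m
    unfolding generated_algebra_def by (intro span_sum span_scale span_base) auto
  then show ?thesis
    using resolvent_sums unfolding sums_def closure_sequential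
    by (intro exI[of _ "\<lambda>m. \<Sum>n<m. scaleC (1 / w ^ Suc n) (X ^ n)"]) simp
qed

lemma state_resolvent_eq_cauchy_transform:
  assumes dist: "has_distribution \<phi> X M" and supp: "AE x in M. \<bar>x\<bar> \<le> R" and R: "R \<ge> 0" and w: "Im w > R"
  shows "\<phi> (resolvent w X) = cauchy_transform M w"
proof -
  interpret real_distribution M using dist by (simp add: has_distribution_def)
  have "(\<lambda>n. \<phi> (X ^ n) / w ^ Suc n) sums cauchy_transform M w"
    using cauchy_transform_moments[OF supp R w] dist by (simp add: has_distribution_def)
  then show ?thesis
    by (rule sums_unique2[OF state_resolvent_sums])
qed

end

text \<open>The normalised resolvent minus \<open>1\<close> is a centred element; its norm has to be below \<open>1\<close> for the geometric series
  below. If \<open>norm X\<close> is at most \<open>norm w / 5\<close>, the Neumann series and its expectation are within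
  \<open>(1/5) / (1 - 1/5) = 1/4\<close> of \<open>1\<close>, so the norm is at most \<open>(1/4 + 1/4) / (1 - 1/4) = 2/3\<close>.\<close>

lemma norm_centred_resolvent:
  assumes "5 * norm X \<le> norm w" "w \<noteq> 0"
  shows "\<phi> (resolvent w X) \<noteq> 0"
    and "norm (scaleC (1 / \<phi> (resolvent w X)) (resolvent w X) - 1) < 1"
proof -
  have large: "norm X < norm w"
    using assms norm_ge_zero[of X] zero_less_norm_iff[of w] by linarith
  define N where "N = (\<Sum>n. scaleC (1 / w) X ^ n)"
  have "norm (scaleC (1 / w) X) \<le> 1 / 5"
    using assms by (simp add: norm_scaleC norm_divide pos_divide_le_eq)
  then have "norm (scaleC (1 / w) X) / (1 - norm (scaleC (1 / w) X)) \<le> (1 / 5) / (1 - 1 / 5)"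
    by (intro frac_le) auto
  also have "(1 / 5) / (1 - 1 / 5) = (1 / 4 :: real)" by simp
  finally have e: "norm (N - 1) \<le> 1 / 4"
    unfolding N_def by (rule order_trans[OF norm_neumann_minus_1[OF norm_quotient_lt_1[OF large]]])
  define c where "c = \<phi> N"
  have c: "norm (c - 1) \<le> 1 / 4"
    using e state_norm[of "N - 1"] by (simp add: c_def state_diff state_one)
  then have c_ge: "norm c \<ge> 3 / 4"
    using norm_triangle_ineq2[of 1 "1 - c"] by (simp add: norm_minus_commute)
  have c0: "c \<noteq> 0" using c_ge by fastforce
  have g: "\<phi> (resolvent w X) = c / w"
    by (simp add: resolvent_def state_scaleC c_def N_def)
  show nz: "\<phi> (resolvent w X) \<noteq> 0"
    unfolding g using c0 assms by simp
  have "scaleC (1 / \<phi> (resolvent w X)) (resolvent w X) - 1 = scaleC (1 / c) N - 1"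
    unfolding g using assms by (simp add: resolvent_def N_def)
  also have "\<dots> = scaleC (1 / c) ((N - 1) - scaleC (c - 1) 1)"
    using c0 by (simp add: scale_right_diff_distrib scale_left_diff_distrib)
  also have "norm \<dots> = norm ((N - 1) - scaleC (c - 1) 1) / norm c"
    by (simp add: norm_scaleC norm_divide)
  also have "\<dots> \<le> (1 / 4 + 1 / 4) / (3 / 4)"
    using norm_triangle_ineq4[of "N - 1" "scaleC (c - 1) 1"] e c c_ge c0
    by (intro frac_le) (auto simp: norm_scaleC)
  finally show "norm (scaleC (1 / \<phi> (resolvent w X)) (resolvent w X) - 1) < 1" by simp
qed

lemma centred_approximation:
  assumes one: "1 \<in> A" and diff: "\<And>a b. a \<in> A \<Longrightarrow> b \<in> A \<Longrightarrow> a - b \<in> A"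
    and scale: "\<And>c a. a \<in> A \<Longrightarrow> scaleC c a \<in> A"
    and a: "a \<in> closure A" "\<phi> a = 0"
  shows "\<exists>s. (\<forall>n. s n \<in> A) \<and> (\<forall>n. \<phi> (s n) = 0) \<and> s \<longlonglongrightarrow> a"
proof -
  obtain s where s: "\<And>n. s n \<in> A" "s \<longlonglongrightarrow> a"
    using a by (auto simp: closure_sequential)
  have "(\<lambda>n. norm (scaleC (\<phi> (s n)) 1)) \<longlonglongrightarrow> 0"
    using tendsto_norm[OF bounded_linear.tendsto[OF bounded_linear_state s(2)]] a by (simp add: norm_scaleC)
  then have "(\<lambda>n. s n - scaleC (\<phi> (s n)) 1) \<longlonglongrightarrow> a - 0"
    by (intro tendsto_diff s tendsto_norm_zero_cancel[of "\<lambda>n. scaleC (\<phi> (s n)) 1"])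
  then show ?thesis
    using s one diff scale by (intro exI[of _ "\<lambda>n. s n - scaleC (\<phi> (s n)) 1"]) (auto simp: state_diff state_scaleC state_one)
qed

lemma tendsto_prod_list:
  assumes "\<And>p. p \<in> set ws \<Longrightarrow> (\<lambda>n. s p n :: 'a) \<longlonglongrightarrow> l p"
  shows "(\<lambda>n. prod_list (map (\<lambda>p. s p n) ws)) \<longlonglongrightarrow> prod_list (map l ws)"
  using assms by (induction ws) (auto intro!: tendsto_mult)

text \<open>Freeness speaks of polynomials, but resolvents are only norm limits of polynomials. A centred limit is the limit
  of centred polynomials, and products and the state are continuous.\<close>

lemma free_subalgebras_closure:
  assumes free: "free_subalgebras \<phi> A"
    and one: "\<And>i. 1 \<in> A i" and diff: "\<And>i a b. a \<in> A i \<Longrightarrow> b \<in> A i \<Longrightarrow> a - b \<in> A i"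
    and scale: "\<And>i c a. a \<in> A i \<Longrightarrow> scaleC c a \<in> A i"
  shows "free_subalgebras \<phi> (\<lambda>i. closure (A i))"
  unfolding free_subalgebras_def
proof (intro allI impI)
  fix ws :: "('b \<times> 'a) list"
  assume ne: "ws \<noteq> []" and elems: "\<forall>(i, a)\<in>set ws. a \<in> closure (A i) \<and> \<phi> a = 0"
    and alt: "\<forall>k. Suc k < length ws \<longrightarrow> fst (ws ! k) \<noteq> fst (ws ! Suc k)"
  have "\<exists>s. (\<forall>n. s n \<in> A (fst p)) \<and> (\<forall>n. \<phi> (s n) = 0) \<and> s \<longlonglongrightarrow> snd p" if "p \<in> set ws" for p
  proof -
    have closure: "snd p \<in> closure (A (fst p))" "\<phi> (snd p) = 0"
      using elems that by auto
    show ?thesis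
      by (rule centred_approximation[OF one diff scale closure])
  qed
  then obtain s where s: "\<And>p n. p \<in> set ws \<Longrightarrow> s p n \<in> A (fst p)" "\<And>p n. p \<in> set ws \<Longrightarrow> \<phi> (s p n) = 0"
    "\<And>p. p \<in> set ws \<Longrightarrow> s p \<longlonglongrightarrow> snd p"
    by metis
  have "\<phi> (prod_list (map (\<lambda>p. s p n) ws)) = 0" for n
  proof -
    have "\<phi> (prod_list (map snd (map (\<lambda>p. (fst p, s p n)) ws))) = 0"
      by (rule free[unfolded free_subalgebras_def, rule_format]) (use ne alt s in auto)
    then show ?thesis by (simp add: o_def)
  qed
  moreover have "(\<lambda>n. \<phi> (prod_list (map (\<lambda>p. s p n) ws))) \<longlonglongrightarrow> \<phi> (prod_list (map snd ws))"
    by (intro bounded_linear.tendsto[OF bounded_linear_state] tendsto_prod_list s(3))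
  ultimately have "(\<lambda>n::nat. 0) \<longlonglongrightarrow> \<phi> (prod_list (map snd ws))" by simp
  then show "\<phi> (prod_list (map snd ws)) = 0" by (simp add: LIMSEQ_const_iff)
qed

end

fun alternating_word :: "'b \<Rightarrow> 'b \<Rightarrow> nat \<Rightarrow> 'b list" where
  "alternating_word p q 0 = []"
| "alternating_word p q (Suc n) = p # alternating_word q p n"

lemma length_alternating_word [simp]: "length (alternating_word p q n) = n"
  by (induction n arbitrary: p q) auto

lemma nth_alternating_word: "k < n \<Longrightarrow> alternating_word p q n ! k = (if even k then p else q)"
  by (induction n arbitrary: p q k) (auto simp: nth_Cons split: nat.split)

lemma set_alternating_word: "set (alternating_word p q n) \<subseteq> {p, q}"
  by (induction n arbitrary: p q) auto

lemma prod_alternating_word_even: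
  "prod_list (map snd (alternating_word p q (2 * n))) = (snd p * snd q :: 'a::monoid_mult) ^ n"
  by (induction n) (simp_all add: mult.assoc)

lemma prod_alternating_word_odd:
  "prod_list (map snd (alternating_word p q (Suc (2 * n)))) = (snd p * snd q :: 'a::monoid_mult) ^ n * snd p"
proof (induction n)
  case (Suc n)
  have "alternating_word p q (Suc (2 * Suc n)) = p # q # alternating_word p q (Suc (2 * n))" by simp
  then show ?case by (simp only: list.map prod_list.Cons Suc.IH power_Suc mult.assoc)
qed simp

context cstar_probability_space
begin

lemma free_alternating_word:
  assumes free: "free_subalgebras \<phi> A" and "i \<noteq> j"
    and "a \<in> A i" "\<phi> a = 0" "b \<in> A j" "\<phi> b = 0" and "n > 0"
  shows "\<phi> (prod_list (map snd (alternating_word (i, a) (j, b) n))) = 0"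
proof (rule free[unfolded free_subalgebras_def, rule_format])
  show "alternating_word (i, a) (j, b) n \<noteq> []"
    using length_alternating_word[of "(i, a)" "(j, b)" n] \<open>n > 0\<close> by force
  show "case p of (i, a) \<Rightarrow> a \<in> A i \<and> \<phi> a = 0" if "p \<in> set (alternating_word (i, a) (j, b) n)" for p
    using that set_alternating_word[of "(i, a)" "(j, b)" n] assms by auto
  show "fst (alternating_word (i, a) (j, b) n ! k) \<noteq> fst (alternating_word (i, a) (j, b) n ! Suc k)"
    if "Suc k < length (alternating_word (i, a) (j, b) n)" for k
    using that \<open>i \<noteq> j\<close> by (auto simp: nth_alternating_word)
qed

text \<open>Expanding the outer factors turns every term of the series into a sum of alternating words in the centred free
  elements \<open>a\<close> and \<open>b\<close>. The only word of length zero occurs once, for \<open>n = 0\<close>.\<close>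

lemma state_free_geometric:
  assumes free: "free_subalgebras \<phi> A" and ij: "i \<noteq> j"
    and a: "a \<in> A i" "\<phi> a = 0" "norm a < 1" and b: "b \<in> A j" "\<phi> b = 0" "norm b < 1"
  shows "\<phi> ((1 + b) * (\<Sum>n. (a * b) ^ n) * (1 + a)) = 1"
proof -
  have lt: "norm (a * b) < 1"
    using norm_mult_ineq[of a b] mult_strict_mono[of "norm a" 1 "norm b" 1] a b by auto
  note ab = free_alternating_word[OF free ij a(1,2) b(1,2)]
  note ba = free_alternating_word[OF free ij[symmetric] b(1,2) a(1,2)]
  have value_n: "\<phi> ((1 + b) * (a * b) ^ n * (1 + a)) = (if n = 0 then 1 else 0)" for n
  proof -
    have 1: "\<phi> ((a * b) ^ n * a) = 0"
      using ab[of "Suc (2 * n)"] unfolding prod_alternating_word_odd by simp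
    have bab: "b * (a * b) ^ n = (b * a) ^ n * b"
      by (induction n) (simp_all add: mult.assoc)
    have 2: "\<phi> (b * (a * b) ^ n) = 0"
      using ba[of "Suc (2 * n)"] unfolding prod_alternating_word_odd bab by simp
    have "b * (a * b) ^ n * a = (b * a) ^ Suc n"
      unfolding bab by (simp only: power_Suc2 mult.assoc)
    then have 3: "\<phi> (b * (a * b) ^ n * a) = 0"
      using ba[of "2 * Suc n"] unfolding prod_alternating_word_even by simp
    have 4: "\<phi> ((a * b) ^ n) = (if n = 0 then 1 else 0)"
      using ab[of "2 * n"] unfolding prod_alternating_word_even by (simp add: state_one)
    have "(1 + b) * (a * b) ^ n * (1 + a)
        = (a * b) ^ n + b * (a * b) ^ n + ((a * b) ^ n * a + b * (a * b) ^ n * a)"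
      by (simp add: distrib_left distrib_right)
    then show ?thesis by (simp only: state_add 1 2 3 4) simp
  qed
  have "(\<lambda>n. (1 + b) * (a * b) ^ n * (1 + a)) sums ((1 + b) * (\<Sum>n. (a * b) ^ n) * (1 + a))"
    by (intro sums_mult sums_mult2 neumann_sums lt)
  from bounded_linear.sums[OF bounded_linear_state this]
  have "(\<lambda>n. if n = 0 then 1 else 0) sums \<phi> ((1 + b) * (\<Sum>n. (a * b) ^ n) * (1 + a))"
    unfolding value_n .
  moreover have "(\<lambda>n. if n = 0 then 1 else 0 :: complex) sums 1"
    by (rule sums_single)
  ultimately show ?thesis by (rule sums_unique2)
qed

lemma generated_algebra_one: "1 \<in> generated_algebra scaleC X"
  unfolding generated_algebra_def by (rule span_base) (auto intro: range_eqI[of _ _ 0])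

lemma generated_algebra_diff:
  "a \<in> generated_algebra scaleC X \<Longrightarrow> b \<in> generated_algebra scaleC X \<Longrightarrow> a - b \<in> generated_algebra scaleC X"
  unfolding generated_algebra_def by (rule span_diff)

lemma generated_algebra_scale: "a \<in> generated_algebra scaleC X \<Longrightarrow> scaleC c a \<in> generated_algebra scaleC X"
  unfolding generated_algebra_def by (rule span_scale)

lemma centred_resolvent_in_closure:
  assumes "norm X < norm w"
  shows "scaleC c (resolvent w X) - 1 \<in> closure (generated_algebra scaleC X)"
proof -
  have "(\<lambda>a. scaleC c a - 1) ` closure (generated_algebra scaleC X) \<subseteq> closure (generated_algebra scaleC X)"
  proof (rule image_closure_subset)
    show "continuous_on (closure (generated_algebra scaleC X)) (\<lambda>a. scaleC c a - 1)"
      by (intro continuous_intros bounded_linear.continuous_on[OF bounded_linear_scaleC])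
    show "(\<lambda>a. scaleC c a - 1) ` generated_algebra scaleC X \<subseteq> closure (generated_algebra scaleC X)"
      using generated_algebra_diff[OF generated_algebra_scale generated_algebra_one] closure_subset by blast
  qed simp
  then show ?thesis
    using resolvent_in_closure[OF assms] by blast
qed

text \<open>Write the two resolvents as \<open>g (1 + a)\<close> and \<open>g (1 + b)\<close> with \<open>a\<close> and \<open>b\<close> centred. Then \<open>u - X = g\<^sup>-\<^sup>1 (1 + a)\<^sup>-\<^sup>1\<close> and
  \<open>v - Y = g\<^sup>-\<^sup>1 (1 + b)\<^sup>-\<^sup>1\<close>, so
  \<open>z - X - Y = g\<^sup>-\<^sup>1 ((1 + a)\<^sup>-\<^sup>1 + (1 + b)\<^sup>-\<^sup>1 - 1) = g\<^sup>-\<^sup>1 (1 + a)\<^sup>-\<^sup>1 (1 - a b) (1 + b)\<^sup>-\<^sup>1\<close>.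
  The inverse \<open>g (1 + b) (1 - a b)\<^sup>-\<^sup>1 (1 + a)\<close> has expectation \<open>g\<close> by freeness.\<close>

theorem state_resolvent_free_sum:
  assumes free: "free_pair scaleC \<phi> X Y"
    and large: "5 * norm X \<le> norm u" "u \<noteq> 0" "5 * norm Y \<le> norm v" "v \<noteq> 0"
    and g: "\<phi> (resolvent u X) = g" "\<phi> (resolvent v Y) = g"
    and z: "z = u + v - 1 / g" "norm (X + Y) < norm z"
  shows "\<phi> (resolvent z (X + Y)) = g"
proof -
  have large': "norm X < norm u" "norm Y < norm v"
    using large norm_ge_zero[of X] norm_ge_zero[of Y] zero_less_norm_iff[of u] zero_less_norm_iff[of v] by linarith+
  define Ru Rv where "Ru = resolvent u X" and "Rv = resolvent v Y"
  define a b where "a = scaleC (1 / g) Ru - 1" and "b = scaleC (1 / g) Rv - 1"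
  have g0: "g \<noteq> 0" using norm_centred_resolvent(1)[OF large(1,2)] g by simp
  have na: "norm a < 1" and nb: "norm b < 1"
    using norm_centred_resolvent(2)[OF large(1,2)] norm_centred_resolvent(2)[OF large(3,4)] g
    by (simp_all add: a_def b_def Ru_def Rv_def)
  have \<phi>a: "\<phi> a = 0" and \<phi>b: "\<phi> b = 0"
    using g g0 by (simp_all add: a_def b_def Ru_def Rv_def state_diff state_scaleC state_one)
  define A where "A = (\<lambda>i::bool. closure (generated_algebra scaleC (if i then X else Y)))"
  have freeA: "free_subalgebras \<phi> A"
    unfolding A_def using free unfolding free_pair_def
    by (rule free_subalgebras_closure) (rule generated_algebra_one generated_algebra_diff generated_algebra_scale; assumption?)+
  have aA: "a \<in> A True" and bA: "b \<in> A False"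
    using centred_resolvent_in_closure[OF large'(1)] centred_resolvent_in_closure[OF large'(2)]
    by (simp_all add: A_def a_def b_def Ru_def Rv_def)
  define T where "T = (\<Sum>n. (a * b) ^ n)"
  have lt: "norm (a * b) < 1"
    using norm_mult_ineq[of a b] mult_strict_mono[of "norm a" 1 "norm b" 1] na nb by auto
  define S where "S = scaleC g ((1 + b) * T * (1 + a))"
  have \<phi>S: "\<phi> S = g"
    using state_free_geometric[OF freeA _ aA \<phi>a na bA \<phi>b nb]
    by (simp add: S_def T_def state_scaleC)
  define p q where "p = scaleC u 1 - X" and "q = scaleC v 1 - Y"
  have Ru: "scaleC g (1 + a) = Ru" and Rv: "scaleC g (1 + b) = Rv"
    using g0 by (simp_all add: a_def b_def)
  have pR: "p * Ru = 1" and qR: "q * Rv = 1"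
    unfolding p_def q_def Ru_def Rv_def by (rule resolvent_right[OF large'(1)] resolvent_right[OF large'(2)])+
  have pa: "scaleC g (p * (1 + a)) = 1"
    using pR unfolding Ru[symmetric] scaleC_mult_right .
  have qb: "scaleC g (q * (1 + b)) = 1"
    using qR unfolding Rv[symmetric] scaleC_mult_right .
  have zXY: "scaleC z 1 - (X + Y) = p + q - scaleC (1 / g) 1"
    by (simp add: z(1) p_def q_def scale_left_diff_distrib scale_left_distrib)
  have key: "scaleC g (scaleC z 1 - (X + Y)) * (1 + b) = scaleC g p * (1 - a * b)"
  proof -
    have "scaleC g (scaleC z 1 - (X + Y)) * (1 + b) = scaleC g p * (1 + b) + scaleC g (q * (1 + b)) - (1 + b)"
      unfolding zXY using g0
      by (simp add: scale_right_distrib scale_right_diff_distrib scaleC_mult_left algebra_simps)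
    also have "\<dots> = scaleC g p * (1 + b) - scaleC g (p * (1 + a)) * b"
      unfolding pa qb by simp
    also have "\<dots> = scaleC g p * (1 - a * b)"
      by (simp add: scaleC_mult_left algebra_simps scale_right_distrib)
    finally show ?thesis .
  qed
  have "(scaleC z 1 - (X + Y)) * S = (scaleC g (scaleC z 1 - (X + Y)) * (1 + b)) * (T * (1 + a))"
    by (simp add: S_def scaleC_mult_left scaleC_mult_right mult.assoc)
  also have "\<dots> = scaleC g p * ((1 - a * b) * T) * (1 + a)"
    unfolding key by (simp only: mult.assoc)
  also have "\<dots> = 1"
    unfolding T_def neumann_right[OF lt] using pa by (simp add: scaleC_mult_left)
  finally have right: "(scaleC z 1 - (X + Y)) * S = 1" .
  have "resolvent z (X + Y) = resolvent z (X + Y) * ((scaleC z 1 - (X + Y)) * S)"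
    unfolding right by simp
  also have "\<dots> = S"
    unfolding mult.assoc[symmetric] resolvent_left[OF z(2)] by simp
  finally show ?thesis using \<phi>S by simp
qed

end


section \<open>Subordination and the limit theorem\<close>

context cstar_probability_space
begin

text \<open>The fixed points \<open>a\<close> and \<open>b\<close> of the iteration are the values at \<open>z\<close> of the subordination functions of the free
  convolution. The bound \<open>y\<close> ensures at once that the iteration is a contraction, that all three Cauchy transforms are
  given by their moments, and that the resolvents at \<open>a\<close>, \<open>b\<close> and \<open>z\<close> are given by Neumann series.\<close>

theorem subordination_at_infinity:
  assumes M: "real_distribution M" "compactly_supported M" and N: "real_distribution N" "compactly_supported N"
    and free: "free_pair scaleC \<phi> X Y"
    and distX: "has_distribution \<phi> X M" and distY: "has_distribution \<phi> Y N"
    and distXY: "has_distribution \<phi> (X + Y) MN"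
  obtains y where "y > 0"
    "\<And>z. Im z > y \<Longrightarrow> \<exists>a b. (\<lambda>n. F_transform (orth_conv_iter n N M) z) \<longlonglongrightarrow> a \<and>
       (\<lambda>n. F_transform (orth_conv_iter n M N) z) \<longlonglongrightarrow> b \<and> a + b = z + F_transform MN z"
proof -
  interpret M: real_distribution M by fact
  interpret N: real_distribution N by fact
  have MN: "real_distribution MN" "compactly_supported MN"
    using distXY by (auto simp: has_distribution_def)
  obtain C1 D1 where "nevanlinna_map (F_transform M) C1 D1" using nevanlinna_map_F_transform[OF M] .
  then interpret FM: nevanlinna_map "F_transform M" C1 D1 .
  obtain C2 D2 where "nevanlinna_map (F_transform N) C2 D2" using nevanlinna_map_F_transform[OF N] .
  then interpret FN: nevanlinna_map "F_transform N" C2 D2 .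
  obtain Y1 where Y1: "Y1 > 0" "\<And>u v. Im u \<ge> Y1 \<Longrightarrow> Im v \<ge> Y1 \<Longrightarrow>
      norm ((u - F_transform M u) - (v - F_transform M v)) \<le> 1 / 2 * norm (u - v)"
    by (rule FM.lipschitz_near_infinity) (rule that, assumption, blast)
  obtain Y2 where Y2: "Y2 > 0" "\<And>u v. Im u \<ge> Y2 \<Longrightarrow> Im v \<ge> Y2 \<Longrightarrow>
      norm ((u - F_transform N u) - (v - F_transform N v)) \<le> 1 / 2 * norm (u - v)"
    by (rule FN.lipschitz_near_infinity) (rule that, assumption, blast)
  obtain R1 where R1: "R1 > 0" "AE x in M. \<bar>x\<bar> \<le> R1" using compactly_supported_bound[OF M(2)] .
  obtain R2 where R2: "R2 > 0" "AE x in N. \<bar>x\<bar> \<le> R2" using compactly_supported_bound[OF N(2)] .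
  obtain R3 where R3: "R3 > 0" "AE x in MN. \<bar>x\<bar> \<le> R3" using compactly_supported_bound[OF MN(2)] .
  define y where "y = Y1 + Y2 + R1 + R2 + R3 + 5 * norm X + 5 * norm Y + norm (X + Y)"
  have y: "y > 0" "Y1 \<le> y" "Y2 \<le> y" "R1 \<le> y" "R2 \<le> y" "R3 \<le> y" "5 * norm X \<le> y" "5 * norm Y \<le> y" "norm (X + Y) \<le> y"
    using Y1(1) Y2(1) R1(1) R2(1) R3(1) by (simp_all add: y_def add_pos_nonneg add_nonneg_nonneg)
  show thesis
  proof (rule that[OF y(1)])
    fix z assume z: "Im z > y"
    then have z0: "Im z > 0" and zU: "z \<in> upper_half_plane" using y by (auto simp: upper_half_plane_iff)
    obtain a b where ab: "a \<in> {w. Im w \<ge> Im z}" "b \<in> {w. Im w \<ge> Im z}"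
      "a = z - K_transform N b" "b = z - K_transform M a"
      "(\<lambda>n. F_transform (orth_conv_iter n N M) z) \<longlonglongrightarrow> a"
      "(\<lambda>n. F_transform (orth_conv_iter n M N) z) \<longlonglongrightarrow> b"
    proof (rule alternating_iteration_converges[where S = "{w. Im w \<ge> Im z}"
        and u = "\<lambda>n. F_transform (orth_conv_iter n N M) z" and v = "\<lambda>n. F_transform (orth_conv_iter n M N) z"
        and p = "\<lambda>w. z - K_transform N w" and q = "\<lambda>w. z - K_transform M w"])
      show "closed {w. Im w \<ge> Im z}" by (rule closed_halfspace_Im_ge)
      show "F_transform (orth_conv_iter 0 N M) z \<in> {w. Im w \<ge> Im z}"
        "F_transform (orth_conv_iter 0 M N) z \<in> {w. Im w \<ge> Im z}"
        using M.Im_F_transform_ge[OF z0] N.Im_F_transform_ge[OF z0] by simp_all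
      show "F_transform (orth_conv_iter (Suc n) N M) z = z - K_transform N (F_transform (orth_conv_iter n M N) z)"
        "F_transform (orth_conv_iter (Suc n) M N) z = z - K_transform M (F_transform (orth_conv_iter n N M) z)" for n
        by (rule F_transform_orth_conv_iter_Suc[OF N M zU] F_transform_orth_conv_iter_Suc[OF M N zU])+
      show "z - K_transform N w \<in> {w. Im w \<ge> Im z}" "z - K_transform M w \<in> {w. Im w \<ge> Im z}"
        if "w \<in> {w. Im w \<ge> Im z}" for w
        using that z0 M.Im_F_transform_ge[of w] N.Im_F_transform_ge[of w] by (simp_all add: K_transform_def)
      show "dist (z - K_transform N a) (z - K_transform N b) \<le> 1 / 2 * dist a b"
        "dist (z - K_transform M a) (z - K_transform M b) \<le> 1 / 2 * dist a b"
        if "a \<in> {w. Im w \<ge> Im z}" "b \<in> {w. Im w \<ge> Im z}" for a b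
      proof -
        have shift: "dist (z - k) (z - l) = norm (k - l)" for k l
          by (simp add: dist_norm norm_minus_commute)
        show "dist (z - K_transform N a) (z - K_transform N b) \<le> 1 / 2 * dist a b"
          "dist (z - K_transform M a) (z - K_transform M b) \<le> 1 / 2 * dist a b"
          unfolding shift K_transform_def dist_norm[of a b]
          using Y2(2)[of a b] Y1(2)[of a b] that z y by auto
      qed
    qed (rule that)
    have Im: "Im a > y" "Im b > y" using ab(1,2) z by auto
    then have large: "norm a > y" "norm b > y" "norm z > y"
      using abs_Im_le_cmod[of a] abs_Im_le_cmod[of b] abs_Im_le_cmod[of z] z by linarith+
    define g where "g = cauchy_transform M a"
    \<comment> \<open>Both fixed-point equations say that the reciprocal Cauchy transforms agree, with value \<open>a + b - z\<close>.\<close>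
    have FM: "F_transform M a = a + b - z"
      using arg_cong[OF ab(4), of "\<lambda>w. w + a - z"] by (simp add: K_transform_def algebra_simps)
    have FN: "F_transform N b = a + b - z"
      using arg_cong[OF ab(3), of "\<lambda>w. w + b - z"] by (simp add: K_transform_def algebra_simps)
    have g0: "g \<noteq> 0"
      unfolding g_def using Im y M.cauchy_transform_neq_0 by simp
    have gN: "cauchy_transform N b = g"
    proof -
      have "1 / cauchy_transform N b = 1 / g"
        using FM FN by (simp add: F_transform_def g_def)
      then show ?thesis by simp
    qed
    have "\<phi> (resolvent z (X + Y)) = g"
    proof (rule state_resolvent_free_sum[OF free])
      show "\<phi> (resolvent a X) = g" unfolding g_def
        by (rule state_resolvent_eq_cauchy_transform[OF _ distX R1(2)]) (use large y Im R1 in auto)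
      show "\<phi> (resolvent b Y) = g" unfolding gN[symmetric]
        by (rule state_resolvent_eq_cauchy_transform[OF _ distY R2(2)]) (use large y Im R2 in auto)
      show "z = a + b - 1 / g"
        using FM by (simp add: F_transform_def g_def)
    qed (use large y in auto)
    moreover have "\<phi> (resolvent z (X + Y)) = cauchy_transform MN z"
      by (rule state_resolvent_eq_cauchy_transform[OF _ distXY R3(2)]) (use large y z R3 in auto)
    ultimately have "F_transform MN z = F_transform M a"
      by (simp add: F_transform_def g_def)
    then have "a + b = z + F_transform MN z" using FM by simp
    then show "\<exists>a b. (\<lambda>n. F_transform (orth_conv_iter n N M) z) \<longlonglongrightarrow> a \<and>
       (\<lambda>n. F_transform (orth_conv_iter n M N) z) \<longlonglongrightarrow> b \<and> a + b = z + F_transform MN z"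
      using ab(5,6) by blast
  qed
qed

end

theorem theorem9p3:
  fixes scaleC :: "complex \<Rightarrow> 'a::{real_normed_algebra_1, banach} \<Rightarrow> 'a"
    and star :: "'a \<Rightarrow> 'a" and \<phi> :: "'a \<Rightarrow> complex"
    and X\<^sub>1 X\<^sub>2 :: 'a
    and \<mu> \<nu> \<mu>\<nu> :: "real measure"
  assumes "real_distribution \<mu>" "compactly_supported \<mu>"
    and "real_distribution \<nu>" "compactly_supported \<nu>"
    and "cstar_probability_space scaleC star \<phi>"
    and "star X\<^sub>1 = X\<^sub>1" "star X\<^sub>2 = X\<^sub>2"
    and "free_pair scaleC \<phi> X\<^sub>1 X\<^sub>2"
    and "has_distribution \<phi> X\<^sub>1 \<mu>" "has_distribution \<phi> X\<^sub>2 \<nu>"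
    and "has_distribution \<phi> (X\<^sub>1 + X\<^sub>2) \<mu>\<nu>"
  shows "(\<forall>C. compact C \<and> C \<subseteq> upper_half_plane \<longrightarrow>
            uniform_limit C (\<lambda>m z. F_transform \<mu> (F_transform (orth_conv_iter m \<nu> \<mu>) z))
              (F_transform \<mu>\<nu>) sequentially) \<and>
         (\<forall>C. compact C \<and> C \<subseteq> upper_half_plane \<longrightarrow>
            uniform_limit C
              (\<lambda>m z. K_transform (orth_conv_iter m \<mu> \<nu>) z + K_transform (orth_conv_iter m \<nu> \<mu>) z)
              (K_transform \<mu>\<nu>) sequentially)"
proof -
  interpret cstar_probability_space scaleC star \<phi> by fact
  note \<mu> = assms(1,2) and \<nu> = assms(3,4)
  have \<mu>\<nu>: "real_distribution \<mu>\<nu>"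
    using assms(11) by (simp add: has_distribution_def)
  define f where "f = (\<lambda>n. F_transform (orth_conv_iter n \<nu> \<mu>))"
  define g where "g = (\<lambda>n. F_transform (orth_conv_iter n \<mu> \<nu>))"
  obtain y where y: "y > 0" and lim: "\<And>z. Im z > y \<Longrightarrow>
      \<exists>a b. (\<lambda>n. f n z) \<longlonglongrightarrow> a \<and> (\<lambda>n. g n z) \<longlonglongrightarrow> b \<and> a + b = z + F_transform \<mu>\<nu> z"
    by (rule subordination_at_infinity[OF \<mu> \<nu> assms(8-11)]) (rule that, assumption, simp add: f_def g_def)
  obtain C1 D1 where F1: "nevanlinna_map (F_transform \<mu>) C1 D1" using nevanlinna_map_F_transform[OF \<mu>] .
  obtain C2 D2 where F2: "nevanlinna_map (F_transform \<nu>) C2 D2" using nevanlinna_map_F_transform[OF \<nu>] .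
  have f_near: "norm (f n z - z) \<le> C2 + D2 / Im z" if "Im z > 0" for n z
    unfolding f_def by (rule F_transform_orth_conv_iter_near_id[OF \<nu> \<mu> F2 that])
  have g_near: "norm (g n z - z) \<le> C1 + D1 / Im z" if "Im z > 0" for n z
    unfolding g_def by (rule F_transform_orth_conv_iter_near_id[OF \<mu> \<nu> F1 that])
  have f_hol: "f n holomorphic_on upper_half_plane" and g_hol: "g n holomorphic_on upper_half_plane" for n
    unfolding f_def g_def
    by (rule real_distribution.holomorphic_F_transform real_distribution_orth_conv_iter \<mu> \<nu>)+
  have F_hol: "F_transform \<mu>\<nu> holomorphic_on upper_half_plane"
    by (rule real_distribution.holomorphic_F_transform[OF \<mu>\<nu>])
  have "uniform_limit C (\<lambda>m z. F_transform \<mu> (F_transform (orth_conv_iter m \<nu> \<mu>) z)) (F_transform \<mu>\<nu>) sequentially"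
    if C: "compact C" "C \<subseteq> upper_half_plane" for C
  proof -
    have "uniform_limit C (\<lambda>m z. f m z + g (Suc m) z - z) (F_transform \<mu>\<nu>) sequentially"
    proof (rule vitali_upper_half_plane[OF _ _ F_hol _ y C])
      show "(\<lambda>z. f n z + g (Suc n) z - z) holomorphic_on upper_half_plane" for n
        by (intro holomorphic_intros f_hol g_hol)
      show "norm (f n z + g (Suc n) z - z) \<le> norm z + (C1 + C2) + (D1 + D2) / Im z" if "Im z > 0" for n z
      proof -
        have eq: "f n z + g (Suc n) z - z = z + (f n z - z) + (g (Suc n) z - z)" by simp
        have "norm (f n z + g (Suc n) z - z) \<le> norm z + norm (f n z - z) + norm (g (Suc n) z - z)"
          by (subst eq) (rule order_trans[OF norm_triangle_ineq add_right_mono[OF norm_triangle_ineq]])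
        then show ?thesis
          using f_near[OF that, of n] g_near[OF that, of "Suc n"] by (simp add: add_divide_distrib)
      qed
      show "(\<lambda>n. f n z + g (Suc n) z - z) \<longlonglongrightarrow> F_transform \<mu>\<nu> z" if z: "Im z > y" for z
      proof -
        obtain a b where "(\<lambda>n. f n z) \<longlonglongrightarrow> a" "(\<lambda>n. g n z) \<longlonglongrightarrow> b" and ab: "a + b = z + F_transform \<mu>\<nu> z"
          using lim[OF z] by blast
        then have "(\<lambda>n. f n z + g (Suc n) z - z) \<longlonglongrightarrow> a + b - z"
          by (intro tendsto_intros LIMSEQ_Suc)
        then show ?thesis by (simp add: ab)
      qed
    qed
    \<comment> \<open>This is the recursion for \<open>g (Suc m)\<close>, read as a formula for the composition.\<close>
    moreover have "f m z + g (Suc m) z - z = F_transform \<mu> (F_transform (orth_conv_iter m \<nu> \<mu>) z)" if "z \<in> C" for m z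
    proof -
      have "z \<in> upper_half_plane" using that C by blast
      then show ?thesis
        unfolding f_def g_def F_transform_orth_conv_iter_Suc[OF \<mu> \<nu> \<open>z \<in> upper_half_plane\<close>] K_transform_def by simp
    qed
    ultimately show ?thesis
      by (subst uniform_limit_cong'[where g = "\<lambda>m z. f m z + g (Suc m) z - z" and i = "F_transform \<mu>\<nu>"]) auto
  qed
  moreover have "uniform_limit C
      (\<lambda>m z. K_transform (orth_conv_iter m \<mu> \<nu>) z + K_transform (orth_conv_iter m \<nu> \<mu>) z)
      (K_transform \<mu>\<nu>) sequentially"
    if C: "compact C" "C \<subseteq> upper_half_plane" for C
    unfolding K_transform_def f_def[THEN fun_cong, symmetric] g_def[THEN fun_cong, symmetric]
  proof (rule vitali_upper_half_plane[OF _ _ _ _ y C])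
    show "(\<lambda>z. z - g n z + (z - f n z)) holomorphic_on upper_half_plane" for n
      by (intro holomorphic_intros f_hol g_hol)
    show "(\<lambda>z. z - F_transform \<mu>\<nu> z) holomorphic_on upper_half_plane"
      by (intro holomorphic_intros F_hol)
    show "norm (z - g n z + (z - f n z)) \<le> norm z + (C1 + C2) + (D1 + D2) / Im z" if "Im z > 0" for n z
    proof -
      have "norm (z - g n z + (z - f n z)) \<le> norm (g n z - z) + norm (f n z - z)"
        using norm_triangle_ineq[of "z - g n z" "z - f n z"]
        unfolding norm_minus_commute[of "g n z" z] norm_minus_commute[of "f n z" z] .
      then show ?thesis
        using f_near[OF that, of n] g_near[OF that, of n] norm_ge_zero[of z]
        unfolding add_divide_distrib by linarith
    qed
    show "(\<lambda>n. z - g n z + (z - f n z)) \<longlonglongrightarrow> z - F_transform \<mu>\<nu> z" if z: "Im z > y" for z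
    proof -
      obtain a b where "(\<lambda>n. f n z) \<longlonglongrightarrow> a" "(\<lambda>n. g n z) \<longlonglongrightarrow> b" and ab: "a + b = z + F_transform \<mu>\<nu> z"
        using lim[OF z] by blast
      then have "(\<lambda>n. z - g n z + (z - f n z)) \<longlonglongrightarrow> z - b + (z - a)"
        by (intro tendsto_intros)
      moreover have "z - b + (z - a) = z - F_transform \<mu>\<nu> z"
        using ab by (simp add: algebra_simps)
      ultimately show ?thesis by simp
    qed
  qed
  ultimately show ?thesis by blast
qed

end
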